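(* Under the hypotheses of Theorem 5.1 as described below, assume in addition that $p\not\equiv0$ and $$\lambda\frac{L^3}{4}\Big[\frac{2b}{\pi}+\frac{b\pi^2}{4}\Big]\le1.$$ Then (P) has a unique positive solution in $\{u\in C^2[0,L]:0\le u\le\lambda\sin(\frac{\pi}{L}x),\ 0\ge u''\ge(\lambda\sin(\frac{\pi}{L}x))''\}$, and the iterative sequences starting from $y_0\equiv0$, from $y_0=\lambda\sin(\frac{\pi}{L}x)$, and from any initial function $u_0$ in this set all converge uniformly to this unique positive solution.
   Context: Hypotheses of Theorem 5.1: $L>0$, $a,b,c>0$, $p\in L^1[0,L]$ nonnegative, $\lambda>0$ with $p(x)\le[\lambda\pi^4/L^4+a\lambda\pi^2/L^2+2b\lambda^2\pi/L]\sin(\pi x/L)+2\lambda cL/\pi$ a.e. and $c+b\lambda\pi^2/L^2\le\frac{4(a+2b\lambda L/\pi)}{L^3}\sigma(\sqrt{a+2b\lambda L/\pi}\,L)$, where $\sigma(t):=\dfrac{3t^3}{6t\cosh t+6t-12\sinh t-t^3}$. (P) is $w''''-(a+b\int_0^L w)w''+c\int_0^L w=p$ a.e. in $(0,L)$, $w(0)=w(L)=w''(0)=w''(L)=0$, solutions in $W^{4,1}[0,L]$. With $M=a+2b\lambda L/\pi$, $N=c+b\lambda\pi^2/L^2$, the iteration is: $y_n\in W^{4,1}[0,L]$ is the unique solution of $y_n''''-My_n''+N\int_0^L y_n=p+b\,y_{n-1}''\int_0^L y_{n-1}-2b\lambda\frac{L}{\pi}y_{n-1}''+b\lambda\frac{\pi^2}{L^2}\int_0^L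 y_{n-1}$ with $y_n(0)=y_n(L)=y_n''(0)=y_n''(L)=0$. *)

theory Defs
  imports "HOL-Analysis.Analysis"
begin

definition sigma5 :: "real \<Rightarrow> real" where
  "sigma5 t = 3 * t ^ 3 / (6 * t * cosh t + 6 * t - 12 * sinh t - t ^ 3)"

definition C2_on :: "real \<Rightarrow> (real \<Rightarrow> real) \<Rightarrow> (real \<Rightarrow> real) \<Rightarrow> bool" where
  "C2_on L u u2 \<longleftrightarrow>
     (\<exists>u1. (\<forall>x\<in>{0..L}. (u has_real_derivative u1 x) (at x within {0..L})
                      \<and> (u1 has_real_derivative u2 x) (at x within {0..L}))
           \<and> continuous_on {0..L} u2)"

text \<open>w belongs to W^{4,1}[0,L], with second derivative w2 and (a.e.) fourth
  derivative w4: w is C^3 on [0,L] and w''' is absolutely continuous, i.e. the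
  indefinite integral of the L^1 function w4.\<close>
definition W41_on :: "real \<Rightarrow> (real \<Rightarrow> real) \<Rightarrow> (real \<Rightarrow> real) \<Rightarrow> (real \<Rightarrow> real) \<Rightarrow> bool" where
  "W41_on L w w2 w4 \<longleftrightarrow>
     C2_on L w w2 \<and>
     (\<exists>w3. (\<forall>x\<in>{0..L}. (w2 has_real_derivative w3 x) (at x within {0..L}))
         \<and> w4 absolutely_integrable_on {0..L}
         \<and> (\<forall>x\<in>{0..L}. w3 x = w3 0 + integral {0..x} w4))"

definition solves_P :: "real \<Rightarrow> real \<Rightarrow> real \<Rightarrow> real \<Rightarrow> (real \<Rightarrow> real) \<Rightarrow> (real \<Rightarrow> real) \<Rightarrow> bool" where
  "solves_P L a b c p w \<longleftrightarrow>
     (\<exists>w2 w4. W41_on L w w2 w4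
        \<and> w 0 = 0 \<and> w L = 0 \<and> w2 0 = 0 \<and> w2 L = 0
        \<and> (AE x in lebesgue. x \<in> {0<..<L} \<longrightarrow>
              w4 x - (a + b * integral {0..L} w) * w2 x + c * integral {0..L} w = p x))"

definition setK :: "real \<Rightarrow> real \<Rightarrow> (real \<Rightarrow> real) \<Rightarrow> bool" where
  "setK L lam u \<longleftrightarrow>
     (\<exists>u2. C2_on L u u2 \<and>
        (\<forall>x\<in>{0..L}. 0 \<le> u x \<and> u x \<le> lam * sin (pi / L * x)
                    \<and> u2 x \<le> 0 \<and> - lam * (pi / L) ^ 2 * sin (pi / L * x) \<le> u2 x))"

definition iter_seq :: "real \<Rightarrow> real \<Rightarrow> real \<Rightarrow> real \<Rightarrow> real \<Rightarrow> (real \<Rightarrow> real)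
                        \<Rightarrow> (nat \<Rightarrow> real \<Rightarrow> real) \<Rightarrow> bool" where
  "iter_seq L a b c lam p y \<longleftrightarrow>
     (let M = a + 2 * b * lam * L / pi; N = c + b * lam * pi ^ 2 / L ^ 2 in
      \<exists>y2 :: nat \<Rightarrow> real \<Rightarrow> real.
        C2_on L (y 0) (y2 0) \<and>
        (\<forall>n. \<exists>y4. W41_on L (y (Suc n)) (y2 (Suc n)) y4
           \<and> y (Suc n) 0 = 0 \<and> y (Suc n) L = 0 \<and> y2 (Suc n) 0 = 0 \<and> y2 (Suc n) L = 0
           \<and> (AE x in lebesgue. x \<in> {0<..<L} \<longrightarrow>
                 y4 x - M * y2 (Suc n) x + N * integral {0..L} (y (Suc n))
                 = p x + b * y2 n x * integral {0..L} (y n)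
                   - 2 * b * lam * (L / pi) * y2 n x
                   + b * lam * (pi ^ 2 / L ^ 2) * integral {0..L} (y n))))"

end

theory Submission
  imports Defs
begin

text \<open>
  Write \<open>Q = 2 b \<lambda> L / \<pi>\<close>, \<open>\<kappa> = b \<lambda> \<pi>\<^sup>2 / L\<^sup>2\<close>, so that \<open>M = a + Q\<close> and \<open>N = c + \<kappa>\<close>. The condition involving
  \<^const>\<open>sigma5\<close> says exactly that the Green function of \<open>- z'' + M z\<close> dominates the rank-one correction
  caused by the nonlocal term, so the linear operator \<open>z'''' - M z'' + N \<integral>z\<close> under Navier conditions
  satisfies a maximum principle for both \<open>z\<close> and \<open>- z''\<close>. On the order interval between \<open>0\<close> and
  \<open>\<lambda> sin (\<pi> x / L)\<close>, ordered by \<open>u \<le> w\<close> and \<open>u'' \<ge> w''\<close>, the iteration is therefore monotone, and every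
  orbit stays between the orbits of the two end points. If \<open>z\<close> is the difference of two ordered elements
  and \<open>y\<close> the difference of their successors, then
  \<open>y'''' - (a + Q) y'' + (c + \<kappa>) \<integral>y \<le> - Q z'' + \<kappa> \<integral>z\<close>; testing with \<open>x (L - x) / 2\<close> shows that
  \<open>\<integral>y \<le> \<theta> \<integral>z\<close> for some \<open>\<theta> < 1\<close>, and concavity turns this into uniform convergence.
\<close>

text \<open>The datum \<open>p\<close> is merely integrable, so a fourth derivative is known only
  almost everywhere and the equation cannot be evaluated at a maximum point. Every estimate
  therefore comes from integrating against a smooth test function or from convexity read off a
  monotone first derivative. The constants Q and \<kappa> are the largest values of b times the
  integral of u and of -b u'' on the order interval. The product of b u'' with the integral of u
  decreases along the order; adding -Q u'' and \<kappa> times the integral to both sides turns it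
  into an increasing right-hand side. Since u'' enters there, the order has to control second
  derivatives too. No compactness is used. The gap between the two extreme orbits decays
  geometrically for the functions and, one step later, for their second derivatives. The limit is
  thus built from a uniform limit of second derivatives, and its fixed point property is read off
  the enclosure instead of passing to the limit in the fourth-order equation. The same enclosure
  gives uniqueness and the convergence of every other orbit.\<close>

subsection \<open>Integration by parts for integrable functions\<close>

lemma has_integral_mono_AE:
  fixes f g :: "real \<Rightarrow> real"
  assumes f: "(f has_integral i) {u..v}" and g: "(g has_integral j) {u..v}"
    and ae: "AE x in lebesgue. x \<in> {u<..<v} \<longrightarrow> f x \<le> g x"
  shows "i \<le> j"
proof -
  obtain S where S: "negligible S" "{x. \<not> (x \<in> {u<..<v} \<longrightarrow> f x \<le> g x)} \<subseteq> S"
    using ae unfolding eventually_ae_filter_negligible by blast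
  \<comment> \<open>Altering \<open>g\<close> on the null set and at the end points, where nothing
    is assumed, gives a pointwise inequality and leaves the integral unchanged.\<close>
  define g' where "g' x = (if x \<in> S \<union> {u, v} then f x else g x)" for x
  have "(g' has_integral j) {u..v}"
  proof (rule has_integral_spike[OF _ _ g])
    show "negligible (S \<union> {u, v})"
      using S(1) by (simp add: negligible_Un_eq)
  qed (auto simp: g'_def)
  moreover have "f x \<le> g' x" if "x \<in> {u..v}" for x
    using S(2) that by (force simp: g'_def)
  ultimately show ?thesis
    using has_integral_le[OF f] by blast
qed

lemma absolutely_integrable_continuous_mult:
  fixes f g :: "real \<Rightarrow> real"
  assumes "continuous_on {u..v} f" "g absolutely_integrable_on {u..v}"
  shows "(\<lambda>x. f x * g x) absolutely_integrable_on {u..v}"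
proof (rule absolutely_integrable_bounded_measurable_product_real[OF _ _ _ assms(2)])
  show "f \<in> borel_measurable (lebesgue_on {u..v})"
    using assms(1) by (intro continuous_imp_measurable_on_sets_lebesgue) auto
  show "bounded (f ` {u..v})"
    using assms(1) compact_continuous_image compact_imp_bounded by blast
qed auto

lemma has_integral_derivative:
  fixes f f' :: "real \<Rightarrow> real"
  assumes "u \<le> v" "\<And>x. x \<in> {u..v} \<Longrightarrow> (f has_real_derivative f' x) (at x within {u..v})"
  shows "(f' has_integral (f v - f u)) {u..v}"
  using assms by (intro fundamental_theorem_of_calculus)
    (auto simp: has_real_derivative_iff_has_vector_derivative)

lemma continuous_on_DERIV_within:
  fixes f f' :: "real \<Rightarrow> real"
  assumes "\<And>x. x \<in> S \<Longrightarrow> (f has_real_derivative f' x) (at x within S)"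
  shows "continuous_on S f"
  by (meson DERIV_continuous assms continuous_on_eq_continuous_within)

text \<open>The defect in the integration by parts formula on \<open>[x, y]\<close> is at most a constant times
  \<open>y - x\<close> times the integral of \<open>\<bar>f\<bar>\<close> over \<open>[x, y]\<close>; hence it has derivative zero everywhere,
  although \<open>F\<close> itself is differentiable only almost everywhere.\<close>
lemma absolutely_integrable_by_parts:
  fixes \<phi> \<phi>' f F :: "real \<Rightarrow> real"
  assumes uv: "u \<le> v"
    and \<phi>: "\<And>x. x \<in> {u..v} \<Longrightarrow> (\<phi> has_real_derivative \<phi>' x) (at x within {u..v})"
    and \<phi>'c: "continuous_on {u..v} \<phi>'"
    and f: "f absolutely_integrable_on {u..v}"
    and F: "\<And>x. x \<in> {u..v} \<Longrightarrow> F x = F u + integral {u..x} f"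
  shows "((\<lambda>x. \<phi> x * f x) has_integral (\<phi> v * F v - \<phi> u * F u - integral {u..v} (\<lambda>x. \<phi>' x * F x))) {u..v}"
proof -
  have \<phi>c: "continuous_on {u..v} \<phi>"
    using \<phi> by (rule continuous_on_DERIV_within)
  have fi: "f integrable_on {u..v}" and fai: "(\<lambda>x. \<bar>f x\<bar>) integrable_on {u..v}"
    using f by (auto simp: absolutely_integrable_on_def)
  have Fc: "continuous_on {u..v} F"
    by (rule continuous_on_eq[where f = "\<lambda>x. F u + integral {u..x} f"])
      (auto intro!: continuous_intros indefinite_integral_continuous_1 fi F[symmetric])
  have pfi: "(\<lambda>x. \<phi> x * f x) integrable_on {u..v}"
    using absolutely_integrable_continuous_mult[OF \<phi>c f] by (simp add: absolutely_integrable_on_def)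
  have pFi: "(\<lambda>x. \<phi>' x * F x) integrable_on {u..v}"
    by (intro integrable_continuous_real continuous_intros \<phi>'c Fc)
  define Z where "Z x = integral {u..x} (\<lambda>x. \<phi> x * f x) - \<phi> x * F x
    + integral {u..x} (\<lambda>x. \<phi>' x * F x)" for x
  define A where "A x = integral {u..x} (\<lambda>x. \<bar>f x\<bar>)" for x
  have Ac: "continuous_on {u..v} A"
    unfolding A_def by (intro indefinite_integral_continuous_1 fai)
  obtain C where C: "\<And>x. x \<in> {u..v} \<Longrightarrow> \<bar>\<phi>' x\<bar> \<le> C"
    using compact_imp_bounded[OF compact_continuous_image[OF \<phi>'c compact_Icc]]
    by (force simp: bounded_iff)
  have C0: "0 \<le> C" using C[of u] uv by force
  have Zle: "\<bar>Z y - Z x\<bar> \<le> 2 * C * (y - x) * \<bar>A y - A x\<bar>" if xy: "u \<le> x" "x \<le> y" "y \<le> v" for x y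
  proof -
    have sub: "{x..y} \<subseteq> {u..v}" using xy by auto
    have inc: "integral {u..y} g - integral {u..x} g = integral {x..y} g" if "g integrable_on {u..v}" for g :: "real \<Rightarrow> real"
      using Henstock_Kurzweil_Integration.integral_combine[of u x y g] integrable_subinterval_real[OF that, of u y] xy by auto
    have sf: "f integrable_on {x..y}" and sfa: "(\<lambda>x. \<bar>f x\<bar>) integrable_on {x..y}"
      and spf: "(\<lambda>x. \<phi> x * f x) integrable_on {x..y}" and spF: "(\<lambda>x. \<phi>' x * F x) integrable_on {x..y}"
      using integrable_subinterval_real[OF _ sub] fi fai pfi pFi by blast+
    have dsub: "(\<phi> has_real_derivative \<phi>' s) (at s within {x..y})" if "s \<in> {x..y}" for s
      using \<phi>[of s] sub that by (meson DERIV_subset subsetD)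
    have I\<phi>': "(\<phi>' has_integral (\<phi> y - \<phi> x)) {x..y}"
      by (rule has_integral_derivative[OF xy(2) dsub])
    have FF: "F s - F x = integral {x..s} f" if "s \<in> {x..y}" for s
      using F[of s] F[of x] that xy Henstock_Kurzweil_Integration.integral_combine[of u x s f] integrable_subinterval_real[OF fi, of u s] by auto
    have AA: "A y - A x = integral {x..y} (\<lambda>x. \<bar>f x\<bar>)"
      unfolding A_def by (rule inc[OF fai])
    then have A0: "0 \<le> A y - A x"
      using sfa by (simp add: integral_nonneg)
    have h1: "((\<lambda>s. (\<phi> s - \<phi> y) * f s) has_integral
        (integral {x..y} (\<lambda>x. \<phi> x * f x) - \<phi> y * integral {x..y} f)) {x..y}"
      using has_integral_diff[OF integrable_integral[OF spf] has_integral_mult_right[OF integrable_integral[OF sf], of "\<phi> y"]]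
      by (simp add: left_diff_distrib)
    have h2: "((\<lambda>s. \<phi>' s * (F s - F x)) has_integral
        (integral {x..y} (\<lambda>x. \<phi>' x * F x) - (\<phi> y - \<phi> x) * F x)) {x..y}"
      using has_integral_diff[OF integrable_integral[OF spF] has_integral_mult_left[OF I\<phi>', of "F x"]]
      by (simp add: right_diff_distrib)
    have lip: "\<bar>\<phi> s - \<phi> y\<bar> \<le> C * (y - x)" if s: "s \<in> {x..y}" for s
    proof -
      have "norm (\<phi> y - \<phi> s) \<le> C * norm (y - s)"
        by (rule field_differentiable_bound[of "{x..y}" \<phi> \<phi>']) (use dsub C sub s xy in auto)
      also have "\<dots> \<le> C * (y - x)"
        using s C0 by (intro mult_left_mono) auto
      finally show ?thesis by (simp add: abs_minus_commute)
    qed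
    have "norm (integral {x..y} (\<lambda>s. (\<phi> s - \<phi> y) * f s)) \<le> integral {x..y} (\<lambda>s. C * (y - x) * \<bar>f s\<bar>)"
      using h1 lip integrable_on_cmult_left[OF sfa, of "C * (y - x)"]
      by (intro integral_norm_bound_integral) (auto simp: abs_mult intro!: mult_right_mono)
    then have b1: "\<bar>integral {x..y} (\<lambda>s. (\<phi> s - \<phi> y) * f s)\<bar> \<le> C * (y - x) * (A y - A x)"
      by (simp add: AA)
    have FA: "\<bar>F s - F x\<bar> \<le> A y - A x" if s: "s \<in> {x..y}" for s
    proof -
      have s1: "f integrable_on {x..s}" "(\<lambda>x. \<bar>f x\<bar>) integrable_on {x..s}"
        using sf sfa s by (auto elim!: integrable_subinterval_real)
      have "norm (integral {x..s} f) \<le> integral {x..s} (\<lambda>x. \<bar>f x\<bar>)"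
        using s1 by (intro integral_norm_bound_integral) auto
      also have "\<dots> \<le> integral {x..y} (\<lambda>x. \<bar>f x\<bar>)"
        using s1 sfa s by (intro integral_subset_le) auto
      finally show ?thesis by (simp add: FF[OF s] AA)
    qed
    have "norm (integral {x..y} (\<lambda>s. \<phi>' s * (F s - F x))) \<le> integral {x..y} (\<lambda>s. C * (A y - A x))"
      using h2 FA C C0 sub
      by (intro integral_norm_bound_integral) (auto simp: abs_mult intro!: mult_mono)
    then have b2: "\<bar>integral {x..y} (\<lambda>s. \<phi>' s * (F s - F x))\<bar> \<le> C * (y - x) * (A y - A x)"
      using xy by (simp add: mult_ac)
    \<comment> \<open>Subtracting the constants \<open>\<phi> y\<close> and \<open>F x\<close> makes
      all boundary terms cancel. In the first integral the factor of \<open>f\<close> is then at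
      most \<open>C * (y - x)\<close>; in the second, a bounded integrand of size
      \<open>C * (A y - A x)\<close> is integrated over length \<open>y - x\<close>.\<close>
    have "Z y - Z x = integral {x..y} (\<lambda>s. (\<phi> s - \<phi> y) * f s) + integral {x..y} (\<lambda>s. \<phi>' s * (F s - F x))"
      unfolding integral_unique[OF h1] integral_unique[OF h2] Z_def
      using inc[OF pfi] inc[OF pFi] FF[of y] xy by (simp add: algebra_simps)
    then show ?thesis
      using b1 b2 A0 by (simp add: abs_le_iff algebra_simps)
  qed
  have Zle': "\<bar>Z y - Z x\<bar> \<le> 2 * C * \<bar>y - x\<bar> * \<bar>A y - A x\<bar>" if "x \<in> {u..v}" "y \<in> {u..v}" for x y
    using Zle[of x y] Zle[of y x] that by (cases "x \<le> y") (auto simp: abs_minus_commute)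
  have "(Z has_real_derivative 0) (at x within {u..v})" if x: "x \<in> {u..v}" for x
    unfolding has_field_derivative_iff
  proof (rule tendsto_rabs_zero_cancel, rule tendsto_sandwich[where f = "\<lambda>_. 0" and h = "\<lambda>y. 2 * C * \<bar>A y - A x\<bar>"])
    show "\<forall>\<^sub>F y in at x within {u..v}. \<bar>(Z y - Z x) / (y - x)\<bar> \<le> 2 * C * \<bar>A y - A x\<bar>"
      unfolding eventually_at_filter
      using Zle'[OF x] by (auto intro!: always_eventually simp: divide_simps abs_divide mult_ac)
    have "(A \<longlongrightarrow> A x) (at x within {u..v})"
      using Ac x by (simp add: continuous_on_def)
    then show "((\<lambda>y. 2 * C * \<bar>A y - A x\<bar>) \<longlongrightarrow> 0) (at x within {u..v})"
      by (auto intro!: tendsto_eq_intros)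
  qed auto
  then obtain k where k: "\<And>x. x \<in> {u..v} \<Longrightarrow> Z x = k"
    using has_field_derivative_zero_constant[of "{u..v}" Z] by auto
  have "Z v = Z u" using k uv by simp
  then have "integral {u..v} (\<lambda>x. \<phi> x * f x) = \<phi> v * F v - \<phi> u * F u - integral {u..v} (\<lambda>x. \<phi>' x * F x)"
    by (simp add: Z_def)
  then show ?thesis
    using integrable_integral[OF pfi] by simp
qed

subsection \<open>Navier boundary conditions\<close>

text \<open>A convex function attains its maximum at an end point. Convexity is stated through a
  monotone \<open>f'\<close>, because the principle is also applied to functions whose second
  derivative exists only almost everywhere.\<close>

lemma nonpos_if_derivative_mono:
  fixes f f' :: "real \<Rightarrow> real"
  assumes f: "\<And>x. x \<in> {u..v} \<Longrightarrow> (f has_real_derivative f' x) (at x within {u..v})"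
    and mono: "\<And>x y. u \<le> x \<Longrightarrow> x \<le> y \<Longrightarrow> y \<le> v \<Longrightarrow> f' x \<le> f' y"
    and ends: "f u \<le> 0" "f v \<le> 0" and x: "x \<in> {u..v}"
  shows "f x \<le> 0"
proof (rule ccontr)
  assume neg: "\<not> f x \<le> 0"
  with ends x have ux: "u < x" "x < v"
    by (metis atLeastAtMost_iff order_le_less)+
  have mvt: "\<exists>\<xi>\<in>{s<..<r}. f r - f s = f' \<xi> * (r - s)" if "u \<le> s" "s < r" "r \<le> v" for s r
  proof (rule mvt_simple[OF that(2)])
    fix x assume "s \<le> x" "x \<le> r"
    then have "(f has_real_derivative f' x) (at x within {s..r})"
      using f[of x] that by (force intro: DERIV_subset)
    then show "(f has_derivative (*) (f' x)) (at x within {s..r})"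
      by (rule has_field_derivative_imp_has_derivative)
  qed
  obtain \<xi> where \<xi>: "u < \<xi>" "\<xi> < x" "f x - f u = f' \<xi> * (x - u)"
    using mvt[of u x] ux by auto
  obtain \<eta> where \<eta>: "x < \<eta>" "\<eta> < v" "f v - f x = f' \<eta> * (v - x)"
    using mvt[of x v] ux by auto
  have "0 < f' \<xi> * (x - u)" "f' \<eta> * (v - x) < 0"
    using \<xi>(3) \<eta>(3) neg ends by linarith+
  then have "0 < f' \<xi>" "f' \<eta> < 0"
    using ux by (auto simp: zero_less_mult_iff mult_less_0_iff)
  with mono[of \<xi> \<eta>] \<xi> \<eta> show False by linarith
qed

lemma derivative_mono_if_nonneg:
  fixes f f' :: "real \<Rightarrow> real"
  assumes f: "\<And>x. x \<in> {u..v} \<Longrightarrow> (f has_real_derivative f' x) (at x within {u..v})"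
    and nn: "\<And>x. x \<in> {u..v} \<Longrightarrow> 0 \<le> f' x" and xy: "u \<le> x" "x \<le> y" "y \<le> v"
  shows "f x \<le> f y"
proof -
  have "(f' has_integral (f y - f x)) {x..y}"
  proof (rule has_integral_derivative[OF xy(2)])
    fix s assume "s \<in> {x..y}"
    then show "(f has_real_derivative f' s) (at s within {x..y})"
      using f[of s] xy by (force intro: DERIV_subset)
  qed
  then have "0 \<le> f y - f x"
    using has_integral_nonneg[of f' "f y - f x" "{x..y}"] nn xy by auto
  then show ?thesis by simp
qed

lemma nonpos_if_second_derivative_nonneg:
  fixes f f1 f2 :: "real \<Rightarrow> real"
  assumes "\<And>x. x \<in> {u..v} \<Longrightarrow> (f has_real_derivative f1 x) (at x within {u..v})"
    and "\<And>x. x \<in> {u..v} \<Longrightarrow> (f1 has_real_derivative f2 x) (at x within {u..v})"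
    and "\<And>x. x \<in> {u..v} \<Longrightarrow> 0 \<le> f2 x"
    and "f u \<le> 0" "f v \<le> 0" "x \<in> {u..v}"
  shows "f x \<le> 0"
proof (rule nonpos_if_derivative_mono[OF assms(1) _ assms(4-6)])
  show "f1 x \<le> f1 y" if "u \<le> x" "x \<le> y" "y \<le> v" for x y
    using derivative_mono_if_nonneg[OF assms(2,3) that] .
qed

text \<open>Green's identity with all boundary terms kept: on \<open>[0, x]\<close> and
  \<open>[x, L]\<close> the test functions do not vanish at \<open>x\<close>. Only the first
  integration by parts needs the absolutely continuous version.\<close>

lemma second_order_by_parts:
  fixes \<phi> \<phi>1 \<phi>2 z2 z3 z4 :: "real \<Rightarrow> real"
  assumes uv: "u \<le> v"
    and \<phi>: "\<And>x. x \<in> {u..v} \<Longrightarrow> (\<phi> has_real_derivative \<phi>1 x) (at x within {u..v})"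
    and \<phi>1: "\<And>x. x \<in> {u..v} \<Longrightarrow> (\<phi>1 has_real_derivative \<phi>2 x) (at x within {u..v})"
    and z2: "\<And>x. x \<in> {u..v} \<Longrightarrow> (z2 has_real_derivative z3 x) (at x within {u..v})"
    and z4: "z4 absolutely_integrable_on {u..v}"
    and z3: "\<And>x. x \<in> {u..v} \<Longrightarrow> z3 x = z3 u + integral {u..x} z4"
  shows "((\<lambda>x. \<phi> x * z4 x - \<phi>2 x * z2 x) has_integral
    ((\<phi> v * z3 v - \<phi>1 v * z2 v) - (\<phi> u * z3 u - \<phi>1 u * z2 u))) {u..v}"
proof -
  have c1: "continuous_on {u..v} \<phi>1" using \<phi>1 by (rule continuous_on_DERIV_within)
  have c3: "continuous_on {u..v} z3"
    by (rule continuous_on_eq[where f = "\<lambda>x. z3 u + integral {u..x} z4"])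
      (use z4 in \<open>auto intro!: continuous_intros indefinite_integral_continuous_1 z3[symmetric]
        simp: absolutely_integrable_on_def\<close>)
  have 1: "((\<lambda>x. \<phi> x * z4 x) has_integral
      (\<phi> v * z3 v - \<phi> u * z3 u - integral {u..v} (\<lambda>x. \<phi>1 x * z3 x))) {u..v}"
    by (rule absolutely_integrable_by_parts[OF uv \<phi> c1 z4 z3])
  have 2: "((\<lambda>x. \<phi>1 x * z3 x) has_integral integral {u..v} (\<lambda>x. \<phi>1 x * z3 x)) {u..v}"
    by (intro integrable_integral integrable_continuous_real continuous_intros c1 c3)
  have 3: "((\<lambda>x. \<phi>2 x * z2 x + \<phi>1 x * z3 x) has_integral (\<phi>1 v * z2 v - \<phi>1 u * z2 u)) {u..v}"
    by (rule has_integral_derivative[OF uv]) (auto intro!: derivative_eq_intros \<phi>1 z2)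
  show ?thesis
    using has_integral_diff[OF has_integral_add[OF 1 2] 3] by (simp add: algebra_simps)
qed

text \<open>\<open>z4\<close> is a parameter although it is determined only almost everywhere, so
  that equations and linear combinations can refer to one fixed representative.\<close>

definition navier :: "real \<Rightarrow> (real \<Rightarrow> real) \<Rightarrow> (real \<Rightarrow> real) \<Rightarrow> (real \<Rightarrow> real) \<Rightarrow> bool" where
  "navier L z z2 z4 \<longleftrightarrow> W41_on L z z2 z4 \<and> z 0 = 0 \<and> z L = 0 \<and> z2 0 = 0 \<and> z2 L = 0"

lemma navierE:
  assumes "navier L z z2 z4"
  obtains z1 z3 where
    "\<And>x. x \<in> {0..L} \<Longrightarrow> (z has_real_derivative z1 x) (at x within {0..L})"
    "\<And>x. x \<in> {0..L} \<Longrightarrow> (z1 has_real_derivative z2 x) (at x within {0..L})"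
    "\<And>x. x \<in> {0..L} \<Longrightarrow> (z2 has_real_derivative z3 x) (at x within {0..L})"
    "z4 absolutely_integrable_on {0..L}"
    "\<And>u x. 0 \<le> u \<Longrightarrow> u \<le> x \<Longrightarrow> x \<le> L \<Longrightarrow> z3 x = z3 u + integral {u..x} z4"
    "z 0 = 0" "z L = 0" "z2 0 = 0" "z2 L = 0"
proof -
  from assms obtain z1 z3 where *:
    "\<And>x. x \<in> {0..L} \<Longrightarrow> (z has_real_derivative z1 x) (at x within {0..L})"
    "\<And>x. x \<in> {0..L} \<Longrightarrow> (z1 has_real_derivative z2 x) (at x within {0..L})"
    "\<And>x. x \<in> {0..L} \<Longrightarrow> (z2 has_real_derivative z3 x) (at x within {0..L})"
    "z4 absolutely_integrable_on {0..L}"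
    "\<And>x. x \<in> {0..L} \<Longrightarrow> z3 x = z3 0 + integral {0..x} z4"
    "z 0 = 0" "z L = 0" "z2 0 = 0" "z2 L = 0"
    unfolding navier_def W41_on_def C2_on_def by metis
  \<comment> \<open>Moving the base point from \<open>0\<close> to \<open>u\<close> prepares the
    integration by parts on \<open>[x, L]\<close>.\<close>
  have "z3 x = z3 u + integral {u..x} z4" if "0 \<le> u" "u \<le> x" "x \<le> L" for u x
  proof -
    have "z4 integrable_on {0..x}"
      using *(4) that by (auto simp: absolutely_integrable_on_def elim!: integrable_subinterval_real)
    from Henstock_Kurzweil_Integration.integral_combine[OF that(1,2) this] *(5)[of x] *(5)[of u] that
    show ?thesis by auto
  qed
  with * show ?thesis using that by blast
qed

lemma navierI:
  assumes L: "0 \<le> L"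
    and "\<And>x. x \<in> {0..L} \<Longrightarrow> (z has_real_derivative z1 x) (at x within {0..L})"
    and "\<And>x. x \<in> {0..L} \<Longrightarrow> (z1 has_real_derivative z2 x) (at x within {0..L})"
    and z2: "\<And>x. x \<in> {0..L} \<Longrightarrow> (z2 has_real_derivative z3 x) (at x within {0..L})"
    and "z4 absolutely_integrable_on {0..L}"
    and "\<And>x. x \<in> {0..L} \<Longrightarrow> z3 x = z3 0 + integral {0..x} z4"
    and "z 0 = 0" "z L = 0" "z2 0 = 0" "z2 L = 0"
  shows "navier L z z2 z4"
proof -
  have "continuous_on {0..L} z2" using z2 by (rule continuous_on_DERIV_within)
  with assms show ?thesis
    unfolding navier_def W41_on_def C2_on_def by blast
qed

lemma navier_continuous:
  assumes "navier L z z2 z4"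
  shows "continuous_on {0..L} z" "continuous_on {0..L} z2"
  using assms continuous_on_DERIV_within by (metis navierE)+

lemma navier_add_mult:
  assumes z: "navier L z z2 z4" and w: "navier L w w2 w4" and L: "0 \<le> L"
  shows "navier L (\<lambda>x. z x + r * w x) (\<lambda>x. z2 x + r * w2 x) (\<lambda>x. z4 x + r * w4 x)"
proof -
  obtain z1 z3 where z':
    "\<And>x. x \<in> {0..L} \<Longrightarrow> (z has_real_derivative z1 x) (at x within {0..L})"
    "\<And>x. x \<in> {0..L} \<Longrightarrow> (z1 has_real_derivative z2 x) (at x within {0..L})"
    "\<And>x. x \<in> {0..L} \<Longrightarrow> (z2 has_real_derivative z3 x) (at x within {0..L})"
    "z4 absolutely_integrable_on {0..L}"
    "\<And>u x. 0 \<le> u \<Longrightarrow> u \<le> x \<Longrightarrow> x \<le> L \<Longrightarrow> z3 x = z3 u + integral {u..x} z4"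
    "z 0 = 0" "z L = 0" "z2 0 = 0" "z2 L = 0"
    using navierE[OF z] by metis
  obtain w1 w3 where w':
    "\<And>x. x \<in> {0..L} \<Longrightarrow> (w has_real_derivative w1 x) (at x within {0..L})"
    "\<And>x. x \<in> {0..L} \<Longrightarrow> (w1 has_real_derivative w2 x) (at x within {0..L})"
    "\<And>x. x \<in> {0..L} \<Longrightarrow> (w2 has_real_derivative w3 x) (at x within {0..L})"
    "w4 absolutely_integrable_on {0..L}"
    "\<And>u x. 0 \<le> u \<Longrightarrow> u \<le> x \<Longrightarrow> x \<le> L \<Longrightarrow> w3 x = w3 u + integral {u..x} w4"
    "w 0 = 0" "w L = 0" "w2 0 = 0" "w2 L = 0"
    using navierE[OF w] by metis
  have rw4: "(\<lambda>x. r * w4 x) absolutely_integrable_on {0..L}"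
    using w'(4) by (intro absolutely_integrable_continuous_mult continuous_intros)
  show ?thesis
  proof (rule navierI[where ?z1.0 = "\<lambda>x. z1 x + r * w1 x" and ?z3.0 = "\<lambda>x. z3 x + r * w3 x"])
    fix x assume x: "x \<in> {0..L}"
    have "z4 integrable_on {0..x}" "(\<lambda>x. r * w4 x) integrable_on {0..x}"
      using z'(4) rw4 x integrable_subinterval_real[of _ 0 L 0 x] by (auto simp: absolutely_integrable_on_def)
    then have "integral {0..x} (\<lambda>x. z4 x + r * w4 x) = integral {0..x} z4 + r * integral {0..x} w4"
      by (simp add: Henstock_Kurzweil_Integration.integral_add)
    then show "z3 x + r * w3 x = z3 0 + r * w3 0 + integral {0..x} (\<lambda>x. z4 x + r * w4 x)"
      using z'(5)[of 0 x] w'(5)[of 0 x] x by (simp add: algebra_simps)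
    show "((\<lambda>x. z x + r * w x) has_real_derivative z1 x + r * w1 x) (at x within {0..L})"
      using DERIV_add[OF z'(1)[OF x] DERIV_cmult[OF w'(1)[OF x]]] .
    show "((\<lambda>x. z1 x + r * w1 x) has_real_derivative z2 x + r * w2 x) (at x within {0..L})"
      using DERIV_add[OF z'(2)[OF x] DERIV_cmult[OF w'(2)[OF x]]] .
    show "((\<lambda>x. z2 x + r * w2 x) has_real_derivative z3 x + r * w3 x) (at x within {0..L})"
      using DERIV_add[OF z'(3)[OF x] DERIV_cmult[OF w'(3)[OF x]]] .
  next
    show "(\<lambda>x. z4 x + r * w4 x) absolutely_integrable_on {0..L}"
      using z'(4) rw4 by (rule set_integral_add)
  qed (simp_all add: z'(6-9) w'(6-9) L)
qed

text \<open>The boundary values of z''' are unknown; a test function vanishing at both ends removes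
  them, and the Navier conditions on \<open>z2\<close> remove the rest.\<close>

lemma navier_by_parts:
  assumes z: "navier L z z2 z4" and L: "0 \<le> L"
    and \<phi>: "\<And>x. x \<in> {0..L} \<Longrightarrow> (\<phi> has_real_derivative \<phi>1 x) (at x within {0..L})"
    and \<phi>1: "\<And>x. x \<in> {0..L} \<Longrightarrow> (\<phi>1 has_real_derivative \<phi>2 x) (at x within {0..L})"
    and "\<phi> 0 = 0" "\<phi> L = 0"
  shows "((\<lambda>x. \<phi> x * z4 x - \<phi>2 x * z2 x) has_integral 0) {0..L}"
proof -
  obtain z3 where z':
    "\<And>x. x \<in> {0..L} \<Longrightarrow> (z2 has_real_derivative z3 x) (at x within {0..L})"
    "z4 absolutely_integrable_on {0..L}"
    "\<And>u x. 0 \<le> u \<Longrightarrow> u \<le> x \<Longrightarrow> x \<le> L \<Longrightarrow> z3 x = z3 u + integral {u..x} z4"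
    "z2 0 = 0" "z2 L = 0"
    using navierE[OF z] by metis
  show ?thesis
  proof -
    have "z3 x = z3 0 + integral {0..x} z4" if "x \<in> {0..L}" for x
      using z'(3)[of 0 x] that by auto
    from second_order_by_parts[OF L \<phi> \<phi>1 z'(1,2) this] show ?thesis
      by (simp add: z'(4,5) assms(5,6))
  qed
qed

text \<open>The parabola vanishes at both ends and has second derivative -1, so two integrations by
  parts move it from \<open>z2\<close> to \<open>z\<close>. This links the differential terms with
  the nonlocal one.\<close>

lemma dirichlet_parabola_by_parts:
  assumes z: "\<And>x. x \<in> {0..L} \<Longrightarrow> (z has_real_derivative z1 x) (at x within {0..L})"
    and z1: "\<And>x. x \<in> {0..L} \<Longrightarrow> (z1 has_real_derivative z2 x) (at x within {0..L})"
    and "0 \<le> L" "z 0 = 0" "z L = (0::real)"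
  shows "((\<lambda>x. x * (L - x) / 2 * z2 x) has_integral - integral {0..L} z) {0..L}"
proof -
  have 1: "((\<lambda>x. x * (L - x) / 2 * z2 x + z x) has_integral
      ((\<lambda>x. x * (L - x) / 2 * z1 x - (L / 2 - x) * z x) L
       - (\<lambda>x. x * (L - x) / 2 * z1 x - (L / 2 - x) * z x) 0)) {0..L}"
    by (rule has_integral_derivative[OF \<open>0 \<le> L\<close>])
      (auto intro!: derivative_eq_intros z z1 simp: field_simps)
  have "(z has_integral integral {0..L} z) {0..L}"
    by (intro integrable_integral integrable_continuous_real continuous_on_DERIV_within[OF z])
  from has_integral_diff[OF 1 this] show ?thesis
    using assms by simp
qed

subsection \<open>The maximum principle\<close>

text \<open>\<open>hinge_k\<close> solves \<open>- k'' + m\<^sup>2 k = 1\<close> with Dirichlet conditions and \<open>hinge_h\<close> solves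
  \<open>h'''' - m\<^sup>2 h'' = 1\<close> with Navier conditions; \<open>hinge_h1\<close> and \<open>hinge_h3\<close> are \<open>h'\<close> and \<open>h'''\<close>.\<close>
definition hinge_k :: "real \<Rightarrow> real \<Rightarrow> real \<Rightarrow> real" where
  "hinge_k L m s = (sinh (m * L) - sinh (m * s) - sinh (m * (L - s))) / (m\<^sup>2 * sinh (m * L))"

definition hinge_h :: "real \<Rightarrow> real \<Rightarrow> real \<Rightarrow> real" where
  "hinge_h L m s = (s * (L - s) / 2 - hinge_k L m s) / m\<^sup>2"

definition hinge_h1 :: "real \<Rightarrow> real \<Rightarrow> real \<Rightarrow> real" where
  "hinge_h1 L m s =
    (L / 2 - s + m * (cosh (m * s) - cosh (m * (L - s))) / (m\<^sup>2 * sinh (m * L))) / m\<^sup>2"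

definition hinge_h3 :: "real \<Rightarrow> real \<Rightarrow> real \<Rightarrow> real" where
  "hinge_h3 L m s = m * (cosh (m * s) - cosh (m * (L - s))) / (m\<^sup>2 * sinh (m * L))"

lemma sinh_real_ge:
  fixes x :: real
  assumes "0 \<le> x"
  shows "x \<le> sinh x"
proof -
  have "((\<lambda>x. sinh x - x) has_real_derivative cosh y - 1) (at y within {0..x})" for y :: real
    by (auto intro!: derivative_eq_intros)
  from derivative_mono_if_nonneg[OF this, of 0 x] assms show ?thesis
    by (auto simp: cosh_real_ge_1)
qed

context
  fixes L m :: real
  assumes L: "0 < L" and m: "0 < m"
begin

lemma sinh_mL_pos: "0 < sinh (m * L)"
  using L m by simp

lemma hinge_h_derivatives:
  "(hinge_h L m has_real_derivative hinge_h1 L m s) (at s within S)"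
  "(hinge_h1 L m has_real_derivative - hinge_k L m s) (at s within S)"
  "((\<lambda>s. - hinge_k L m s) has_real_derivative hinge_h3 L m s) (at s within S)"
  "(hinge_h3 L m has_real_derivative 1 - m\<^sup>2 * hinge_k L m s) (at s within S)"
proof -
  note defs = hinge_h_def hinge_h1_def hinge_k_def hinge_h3_def
  have nz: "m \<noteq> 0" "sinh (m * L) \<noteq> 0" using m L by auto
  have S: "((\<lambda>s. sinh (m * s)) has_real_derivative m * cosh (m * s)) (at s within S)"
    "((\<lambda>s. sinh (m * (L - s))) has_real_derivative - m * cosh (m * (L - s))) (at s within S)"
    "((\<lambda>s. cosh (m * s)) has_real_derivative m * sinh (m * s)) (at s within S)"
    "((\<lambda>s. cosh (m * (L - s))) has_real_derivative - m * sinh (m * (L - s))) (at s within S)"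
    by (auto intro!: derivative_eq_intros)
  have sq: "((\<lambda>s. s * (L - s) / 2) has_real_derivative L / 2 - s) (at s within S)"
    by (auto intro!: derivative_eq_intros simp: field_simps)
  have lin: "((\<lambda>s. L / 2 - s) has_real_derivative - 1) (at s within S)"
    by (auto intro!: derivative_eq_intros)
  have k: "(hinge_k L m has_real_derivative - hinge_h3 L m s) (at s within S)"
    unfolding defs[abs_def]
    by (rule DERIV_cong[OF DERIV_cdivide[OF DERIV_diff[OF DERIV_diff[OF DERIV_const S(1)] S(2)]]])
      (use nz in \<open>simp add: divide_simps right_diff_distrib\<close>)
  show "((\<lambda>s. - hinge_k L m s) has_real_derivative hinge_h3 L m s) (at s within S)"
    using DERIV_minus[OF k] by simp
  show h3: "(hinge_h3 L m has_real_derivative 1 - m\<^sup>2 * hinge_k L m s) (at s within S)"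
    unfolding defs[abs_def]
    by (rule DERIV_cong[OF DERIV_cdivide[OF DERIV_cmult[OF DERIV_diff[OF S(3,4)]]]])
      (use nz in \<open>simp add: field_simps power2_eq_square\<close>)
  show "(hinge_h L m has_real_derivative hinge_h1 L m s) (at s within S)"
    unfolding hinge_h_def[abs_def]
    by (rule DERIV_cong[OF DERIV_cdivide[OF DERIV_diff[OF sq k]]]) (simp add: hinge_h1_def hinge_h3_def)
  have "hinge_h1 L m = (\<lambda>s. (L / 2 - s + hinge_h3 L m s) / m\<^sup>2)"
    by (simp add: fun_eq_iff hinge_h1_def hinge_h3_def)
  then show "(hinge_h1 L m has_real_derivative - hinge_k L m s) (at s within S)"
    using DERIV_cong[OF DERIV_cdivide[OF DERIV_add[OF lin h3], where c = "m\<^sup>2"], of "- hinge_k L m s"] nz by simp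
qed

lemma hinge_ends [simp]:
  "hinge_k L m 0 = 0" "hinge_k L m L = 0" "hinge_h L m 0 = 0" "hinge_h L m L = 0"
  by (simp_all add: hinge_k_def hinge_h_def)

lemma hinge_k_nonneg:
  assumes "s \<in> {0..L}" shows "0 \<le> hinge_k L m s"
proof -
  have "sinh (m * L) = sinh (m * s + m * (L - s))" by (simp add: algebra_simps)
  also have "\<dots> = sinh (m * s) * cosh (m * (L - s)) + cosh (m * s) * sinh (m * (L - s))"
    by (rule sinh_add)
  also have "\<dots> \<ge> sinh (m * s) * 1 + 1 * sinh (m * (L - s))"
    using assms m by (intro add_mono mult_left_mono mult_right_mono cosh_real_ge_1) auto
  finally show ?thesis
    using sinh_mL_pos m by (simp add: hinge_k_def)
qed

lemma hinge_h_nonneg: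
  assumes "s \<in> {0..L}" shows "0 \<le> hinge_h L m s"
proof -
  have "- hinge_h L m s \<le> 0"
  proof (rule nonpos_if_second_derivative_nonneg[OF _ _ hinge_k_nonneg _ _ assms])
    show "((\<lambda>s. - hinge_h L m s) has_real_derivative - hinge_h1 L m x) (at x within {0..L})" for x
      by (intro DERIV_minus hinge_h_derivatives)
    show "((\<lambda>s. - hinge_h1 L m s) has_real_derivative hinge_k L m x) (at x within {0..L})" for x
      using DERIV_minus[OF hinge_h_derivatives(2)] by simp
  qed auto
  then show ?thesis by simp
qed

lemma hinge_h_sym: "hinge_h L m (L - s) = hinge_h L m s"
  by (simp add: hinge_h_def hinge_k_def algebra_simps)

text \<open>The second derivative of \<open>hinge_h\<close> is \<open>- hinge_k\<close>, so the
  function is concave and lies below its tangent at \<open>0\<close>.\<close>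

lemma hinge_h_le_linear:
  assumes s: "s \<in> {0..L}" shows "hinge_h L m s \<le> hinge_h1 L m 0 * s"
proof -
  have anti: "0 \<le> hinge_h1 L m 0 - hinge_h1 L m y" if y: "y \<in> {0..L}" for y
  proof -
    have "((\<lambda>s. - hinge_h1 L m s) has_real_derivative hinge_k L m x) (at x within {0..L})" for x
      using DERIV_minus[OF hinge_h_derivatives(2)] by simp
    from derivative_mono_if_nonneg[OF this hinge_k_nonneg, of 0 y] y show ?thesis by auto
  qed
  have "((\<lambda>s. hinge_h1 L m 0 * s - hinge_h L m s) has_real_derivative hinge_h1 L m 0 - hinge_h1 L m x)
      (at x within {0..L})" for x
    using DERIV_diff[OF DERIV_cmult_Id hinge_h_derivatives(1)] .
  from derivative_mono_if_nonneg[OF this anti, of 0 s] s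
  have "hinge_h1 L m 0 * 0 - hinge_h L m 0 \<le> hinge_h1 L m 0 * s - hinge_h L m s"
    by auto
  then show ?thesis by simp
qed

lemma hinge_h1_0_nonneg: "0 \<le> hinge_h1 L m 0"
  using hinge_h_le_linear[of L] L by (simp add: zero_le_mult_iff)


text \<open>Compares the test function for the integral of z with the two test functions for the
  value of z'' at a point. The constant is sharp: both sides have the same slope at
  \<open>s = 0\<close>, respectively at \<open>s = L\<close>.\<close>

lemma hinge_h_le_sinh:
  assumes s: "s \<in> {0..L}"
  shows "hinge_h L m s \<le> hinge_h1 L m 0 / m * sinh (m * s)"
    and "hinge_h L m s \<le> hinge_h1 L m 0 / m * sinh (m * (L - s))"
proof -
  have *: "hinge_h L m s \<le> hinge_h1 L m 0 / m * sinh (m * s)" if "s \<in> {0..L}" for s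
  proof -
    have "hinge_h L m s \<le> hinge_h1 L m 0 / m * (m * s)"
      using hinge_h_le_linear[OF that] m by simp
    also have "\<dots> \<le> hinge_h1 L m 0 / m * sinh (m * s)"
      using sinh_real_ge[of "m * s"] that m hinge_h1_0_nonneg
      by (intro mult_left_mono) auto
    finally show ?thesis .
  qed
  show "hinge_h L m s \<le> hinge_h1 L m 0 / m * sinh (m * s)" using * s .
  show "hinge_h L m s \<le> hinge_h1 L m 0 / m * sinh (m * (L - s))"
    using *[of "L - s"] s by (simp add: hinge_h_sym)
qed

lemma hinge_h_has_integral:
  "(hinge_h L m has_integral
     ((L ^ 3 / 12 - (L - 2 * (cosh (m * L) - 1) / (m * sinh (m * L))) / m\<^sup>2) / m\<^sup>2)) {0..L}"
proof -
  let ?A = "\<lambda>s. (s\<^sup>2 * L / 4 - s ^ 3 / 6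
      - (sinh (m * L) * s - cosh (m * s) / m + cosh (m * (L - s)) / m) / (m\<^sup>2 * sinh (m * L))) / m\<^sup>2"
  have "(hinge_h L m has_integral (?A L - ?A 0)) {0..L}"
    by (rule has_integral_derivative)
      (use L m in \<open>auto intro!: derivative_eq_intros simp: hinge_h_def hinge_k_def field_simps power2_eq_square\<close>)
  moreover have "?A L - ?A 0 = (L ^ 3 / 12 - (L - 2 * (cosh (m * L) - 1) / (m * sinh (m * L))) / m\<^sup>2) / m\<^sup>2"
  proof -
    have "(L\<^sup>2 * L / 4 - L ^ 3 / 6 - (sh * L - ch / m + 1 / m) / (m\<^sup>2 * sh)) / m\<^sup>2
        + (ch / m - 1 / m) / (m\<^sup>2 * sh) / m\<^sup>2
        = (L ^ 3 / 12 - (L - 2 * (ch - 1) / (m * sh)) / m\<^sup>2) / m\<^sup>2" if "sh > 0" for sh ch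
      using that m by (simp add: divide_simps) (simp add: algebra_simps power2_eq_square power3_eq_cube)
    from this[OF sinh_mL_pos, of "cosh (m * L)"] show ?thesis by simp
  qed
  ultimately show ?thesis by simp
qed

lemma hinge_h_integral_nonneg: "0 \<le> integral {0..L} (hinge_h L m)"
  using hinge_h_has_integral hinge_h_nonneg
  by (intro integral_nonneg) auto

text \<open>The defect of the positivity condition at the corner \<open>x \<rightarrow> 0\<close>, \<open>s \<rightarrow> L\<close> of the Green function,
  where it is worst; this is where \<^const>\<open>sigma5\<close> comes from.\<close>
lemma hinge_corner:
  "hinge_h1 L m 0 / m * ((cosh (m * L) - 1) / m) - integral {0..L} (hinge_h L m)
    = (6 * (m * L) * cosh (m * L) + 6 * (m * L) - 12 * sinh (m * L) - (m * L) ^ 3) / (12 * m ^ 5)"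
proof -
  define sh ch where "sh = sinh (m * L)" and "ch = cosh (m * L)"
  have sh: "0 < sh" and sq: "sh * sh = ch * ch - 1"
    using sinh_mL_pos hyperbolic_pythagoras[of "m * L"]
    by (auto simp: sh_def ch_def power2_eq_square algebra_simps)
  have "integral {0..L} (hinge_h L m) = (L ^ 3 / 12 - (L - 2 * (ch - 1) / (m * sh)) / m\<^sup>2) / m\<^sup>2"
    using integral_unique[OF hinge_h_has_integral] by (simp add: sh_def ch_def)
  moreover have "hinge_h1 L m 0 = (L / 2 + m * (1 - ch) / (m\<^sup>2 * sh)) / m\<^sup>2"
    by (simp add: hinge_h1_def sh_def ch_def)
  \<comment> \<open>The term with \<open>sinh\<close> is first written as
    \<open>(ch * ch - 1) / sh\<close>, so that this is a rational identity in independent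
    \<open>sh\<close> and \<open>ch\<close>; the hyperbolic Pythagorean identity enters only
    afterwards.\<close>
  moreover have "(L / 2 + m * (1 - ch) / (m\<^sup>2 * sh)) / m\<^sup>2 / m * ((ch - 1) / m)
      - (L ^ 3 / 12 - (L - 2 * (ch - 1) / (m * sh)) / m\<^sup>2) / m\<^sup>2
      = (6 * (m * L) * ch + 6 * (m * L) - 12 * ((ch * ch - 1) / sh) - (m * L) ^ 3) / (12 * m ^ 5)"
    using m sh by (simp add: divide_simps) (simp add: algebra_simps power2_eq_square power3_eq_cube power_numeral_reduce)
  moreover have "(ch * ch - 1) / sh = sh"
    using sh sq by (simp add: divide_simps)
  ultimately show ?thesis by (simp add: sh_def[symmetric] ch_def[symmetric])
qed

text \<open>The left-hand side is \<open>m\<^sup>2 * sinh (m * L) * hinge_k L m x\<close>, the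
  response of -z'' to a constant source up to a factor. It is compared with the weights that the
  Green representation gives to the sources right and left of \<open>x\<close>. The bound holds
  because \<open>sinh t - sinh (t - y)\<close> equals
  \<open>sinh t * (1 - cosh y) + cosh t * sinh y\<close>.\<close>

lemma hinge_green_le:
  assumes x: "x \<in> {0..L}"
  shows "sinh (m * L) - sinh (m * (L - x)) - sinh (m * x) \<le> (cosh (m * L) - 1) * sinh (m * x)"
    and "sinh (m * L) - sinh (m * (L - x)) - sinh (m * x) \<le> (cosh (m * L) - 1) * sinh (m * (L - x))"
proof -
  have *: "sinh t - sinh (t - y) \<le> cosh t * sinh y" if "0 \<le> t" for t y :: real
  proof -
    have "sinh t * 1 \<le> sinh t * cosh y"
      using that by (intro mult_left_mono cosh_real_ge_1) auto
    then show ?thesis by (simp add: sinh_diff algebra_simps)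
  qed
  show "sinh (m * L) - sinh (m * (L - x)) - sinh (m * x) \<le> (cosh (m * L) - 1) * sinh (m * x)"
    using *[of "m * L" "m * x"] L m by (simp add: algebra_simps)
  show "sinh (m * L) - sinh (m * (L - x)) - sinh (m * x) \<le> (cosh (m * L) - 1) * sinh (m * (L - x))"
    using *[of "m * L" "m * (L - x)"] L m by (simp add: algebra_simps)
qed


text \<open>With \<open>g = z'''' - m\<^sup>2 z'' + N \<integral>z\<close>, testing against \<^const>\<open>hinge_h\<close> determines \<open>\<integral>z\<close>, and testing
  against \<open>sinh (m s)\<close> on \<open>[0, x]\<close> and \<open>sinh (m (L - s))\<close> on \<open>[x, L]\<close> is the Green representation
  of \<open>z'' x\<close>.\<close>
lemma navier_maximum_principle:
  assumes N: "0 < N" and cond: "N \<le> 4 * m\<^sup>2 / L ^ 3 * sigma5 (m * L)"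
    and z: "navier L z z2 z4"
    and g_nonneg: "AE x in lebesgue. x \<in> {0<..<L} \<longrightarrow> 0 \<le> z4 x - m\<^sup>2 * z2 x + N * integral {0..L} z"
    and x: "x \<in> {0..L}"
  shows "z2 x \<le> 0"
proof -
  obtain z1 z3 where z':
    "\<And>x. x \<in> {0..L} \<Longrightarrow> (z has_real_derivative z1 x) (at x within {0..L})"
    "\<And>x. x \<in> {0..L} \<Longrightarrow> (z1 has_real_derivative z2 x) (at x within {0..L})"
    "\<And>x. x \<in> {0..L} \<Longrightarrow> (z2 has_real_derivative z3 x) (at x within {0..L})"
    "z4 absolutely_integrable_on {0..L}"
    "\<And>u x. 0 \<le> u \<Longrightarrow> u \<le> x \<Longrightarrow> x \<le> L \<Longrightarrow> z3 x = z3 u + integral {u..x} z4"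
    and ends: "z 0 = 0" "z L = 0" "z2 0 = 0" "z2 L = 0"
    using navierE[OF z] by metis
  have x0: "0 \<le> x" and xL: "x \<le> L" using x by auto
  define J where "J = integral {0..L} z"
  define g where "g s = z4 s - m\<^sup>2 * z2 s + N * J" for s
  define H where "H = integral {0..L} (hinge_h L m)"
  define h0 where "h0 = hinge_h1 L m 0 / m"
  define \<beta> where "\<beta> = (cosh (m * L) - 1) / m"
  define D where "D = 6 * (m * L) * cosh (m * L) + 6 * (m * L) - 12 * sinh (m * L) - (m * L) ^ 3"
  have H0: "0 \<le> H" and h00: "0 \<le> h0"
    using hinge_h_integral_nonneg hinge_h1_0_nonneg m by (auto simp: H_def h0_def)
  have \<beta>0: "0 \<le> \<beta>" using m cosh_real_ge_1[of "m * L"] by (simp add: \<beta>_def)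
  have corner: "N * h0 * \<beta> \<le> 1 + N * H"
  proof -
    have NM: "N \<le> 12 * m ^ 5 / D"
      using cond L m by (simp add: sigma5_def D_def power_mult_distrib power_numeral_reduce field_simps)
    \<comment> \<open>Positivity of the denominator in \<open>sigma5\<close> follows from
      \<open>N > 0\<close>: a negative \<open>D\<close>, or \<open>D = 0\<close> with the convention
      that the quotient is then 0, would make the upper bound for \<open>N\<close>
      nonpositive.\<close>
    have "0 < D"
    proof (rule ccontr)
      assume "\<not> 0 < D"
      then have "12 * m ^ 5 / D \<le> 0" using m by (intro divide_nonneg_nonpos) auto
      with NM N show False by simp
    qed
    with NM have "N * D \<le> 12 * m ^ 5" by (simp add: field_simps)
    moreover have "h0 * \<beta> - H = D / (12 * m ^ 5)"
      unfolding h0_def \<beta>_def H_def D_def by (rule hinge_corner)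
    ultimately have "N * (h0 * \<beta> - H) \<le> 1"
      using m by (simp only: times_divide_eq_right divide_le_eq) simp
    then show ?thesis by (simp add: algebra_simps)
  qed
  \<comment> \<open>Green's identity turns the test of \<open>z4\<close> with h into that of
    \<open>z2\<close> with -k. Since \<open>m\<^sup>2 * hinge_h\<close> is the parabola minus k, the
    k-terms cancel, and the parabola tested with \<open>z2\<close> gives \<open>- J\<close>.\<close>
  have hg: "((\<lambda>s. hinge_h L m s * g s) has_integral J * (1 + N * H)) {0..L}"
  proof -
    have 1: "((\<lambda>s. hinge_h L m s * z4 s - - hinge_k L m s * z2 s) has_integral 0) {0..L}"
      by (rule navier_by_parts[OF z, of _ "hinge_h1 L m"])
        (use L in \<open>auto intro: hinge_h_derivatives\<close>)
    have 2: "((\<lambda>s. s * (L - s) / 2 * z2 s) has_integral - J) {0..L}"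
      unfolding J_def by (rule dirichlet_parabola_by_parts[OF z'(1,2)]) (use L ends in auto)
    have 3: "(hinge_h L m has_integral H) {0..L}"
      using hinge_h_has_integral unfolding H_def by (metis integral_unique)
    have "hinge_h L m s * g s = hinge_h L m s * z4 s - - hinge_k L m s * z2 s
        - s * (L - s) / 2 * z2 s + N * J * hinge_h L m s" for s
    proof -
      have "m\<^sup>2 * hinge_h L m s = s * (L - s) / 2 - hinge_k L m s"
        using m by (simp add: hinge_h_def)
      then have "hinge_h L m s * (m\<^sup>2 * z2 s) = (s * (L - s) / 2 - hinge_k L m s) * z2 s"
        by (metis mult.assoc mult.commute)
      then show ?thesis by (simp add: g_def algebra_simps)
    qed
    moreover have "J * (1 + N * H) = 0 - - J + N * J * H"
      by (simp add: algebra_simps)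
    ultimately show ?thesis
      using has_integral_add[OF has_integral_diff[OF 1 2] has_integral_mult_right[OF 3, of "N * J"]]
      by (simp only:)
  qed
  define A1 A2 where "A1 = integral {0..x} (\<lambda>s. hinge_h L m s * g s)"
    and "A2 = integral {x..L} (\<lambda>s. hinge_h L m s * g s)"
  have hgi: "(\<lambda>s. hinge_h L m s * g s) integrable_on {0..L}" using hg by blast
  have A1: "((\<lambda>s. hinge_h L m s * g s) has_integral A1) {0..x}"
    and A2: "((\<lambda>s. hinge_h L m s * g s) has_integral A2) {x..L}"
    unfolding A1_def A2_def using x
    by (auto intro!: integrable_integral integrable_subinterval_real[OF hgi])
  have AJ: "A1 + A2 = J * (1 + N * H)"
    unfolding A1_def A2_def
    using Henstock_Kurzweil_Integration.integral_combine[OF x0 xL hgi] integral_unique[OF hg] by simp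
  \<comment> \<open>These are the boundary terms at \<open>x\<close> of the two \<open>sinh\<close>
    tests, plus the contribution of the constant \<open>N * J\<close>. Both contain the unknown
    \<open>z3 x\<close>, with coefficients of opposite sign.\<close>
  define G1 G2 where "G1 = sinh (m * x) * z3 x - m * cosh (m * x) * z2 x + N * J * ((cosh (m * x) - 1) / m)"
    and "G2 = - sinh (m * (L - x)) * z3 x - m * cosh (m * (L - x)) * z2 x
        + N * J * ((cosh (m * (L - x)) - 1) / m)"
  have G1: "((\<lambda>s. sinh (m * s) * g s) has_integral G1) {0..x}"
  proof -
    have "((\<lambda>s. sinh (m * s) * z4 s - m\<^sup>2 * sinh (m * s) * z2 s) has_integral
        ((sinh (m * x) * z3 x - m * cosh (m * x) * z2 x) - (sinh (m * 0) * z3 0 - m * cosh (m * 0) * z2 0))) {0..x}"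
    proof (rule second_order_by_parts[OF x0])
      show "((\<lambda>s. sinh (m * s)) has_real_derivative m * cosh (m * s)) (at s within {0..x})" for s
        by (auto intro!: derivative_eq_intros)
      show "((\<lambda>s. m * cosh (m * s)) has_real_derivative m\<^sup>2 * sinh (m * s)) (at s within {0..x})" for s
        by (auto intro!: derivative_eq_intros simp: power2_eq_square)
      show "(z2 has_real_derivative z3 s) (at s within {0..x})" if "s \<in> {0..x}" for s
        using z'(3)[of s] that xL by (force intro: DERIV_subset)
      show "z4 absolutely_integrable_on {0..x}"
        using z'(4) x by (intro absolutely_integrable_on_subinterval) auto
      show "z3 s = z3 0 + integral {0..s} z4" if "s \<in> {0..x}" for s
        using z'(5)[of 0 s] that xL by auto
    qed
    moreover have "((\<lambda>s. sinh (m * s)) has_integral (cosh (m * x) / m - cosh (m * 0) / m)) {0..x}"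
      by (rule has_integral_derivative[OF x0]) (use m in \<open>auto intro!: derivative_eq_intros\<close>)
    ultimately have "((\<lambda>s. sinh (m * s) * z4 s - m\<^sup>2 * sinh (m * s) * z2 s + N * J * sinh (m * s)) has_integral G1) {0..x}"
      unfolding G1_def
      using has_integral_add[OF _ has_integral_mult_right[of "\<lambda>s. sinh (m * s)" _ _ "N * J"]]
      by (fastforce simp: ends diff_divide_distrib)
    then show ?thesis by (simp add: g_def algebra_simps)
  qed
  have G2: "((\<lambda>s. sinh (m * (L - s)) * g s) has_integral G2) {x..L}"
  proof -
    have "((\<lambda>s. sinh (m * (L - s)) * z4 s - m\<^sup>2 * sinh (m * (L - s)) * z2 s) has_integral
        ((sinh (m * (L - L)) * z3 L - - m * cosh (m * (L - L)) * z2 L)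
          - (sinh (m * (L - x)) * z3 x - - m * cosh (m * (L - x)) * z2 x))) {x..L}"
    proof (rule second_order_by_parts[OF xL])
      show "((\<lambda>s. sinh (m * (L - s))) has_real_derivative - m * cosh (m * (L - s))) (at s within {x..L})" for s
        by (auto intro!: derivative_eq_intros)
      show "((\<lambda>s. - m * cosh (m * (L - s))) has_real_derivative m\<^sup>2 * sinh (m * (L - s))) (at s within {x..L})" for s
        by (auto intro!: derivative_eq_intros simp: power2_eq_square)
      show "(z2 has_real_derivative z3 s) (at s within {x..L})" if "s \<in> {x..L}" for s
        using z'(3)[of s] that x0 by (force intro: DERIV_subset)
      show "z4 absolutely_integrable_on {x..L}"
        using z'(4) x by (intro absolutely_integrable_on_subinterval) auto
      show "z3 s = z3 x + integral {x..s} z4" if "s \<in> {x..L}" for s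
        using z'(5)[of x s] that x0 by auto
    qed
    moreover have "((\<lambda>s. sinh (m * (L - s))) has_integral (- cosh (m * (L - L)) / m - - cosh (m * (L - x)) / m)) {x..L}"
      by (rule has_integral_derivative[OF xL]) (use m in \<open>auto intro!: derivative_eq_intros\<close>)
    ultimately have "((\<lambda>s. sinh (m * (L - s)) * z4 s - m\<^sup>2 * sinh (m * (L - s)) * z2 s + N * J * sinh (m * (L - s))) has_integral G2) {x..L}"
      unfolding G2_def
      using has_integral_add[OF _ has_integral_mult_right[of "\<lambda>s. sinh (m * (L - s))" _ _ "N * J"]]
      by (fastforce simp: ends diff_divide_distrib)
    then show ?thesis by (simp add: g_def algebra_simps)
  qed
  have g0: "AE s in lebesgue. s \<in> {0<..<L} \<longrightarrow> 0 \<le> g s"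
    using g_nonneg by (simp add: g_def J_def)
  have hle: "hinge_h L m s * g s \<le> h0 * (sinh (m * s) * g s)"
    "hinge_h L m s * g s \<le> h0 * (sinh (m * (L - s)) * g s)" if "0 \<le> s" "s \<le> L" "0 \<le> g s" for s
    using mult_right_mono[OF hinge_h_le_sinh(1)[of s] that(3)]
      mult_right_mono[OF hinge_h_le_sinh(2)[of s] that(3)] that
    unfolding h0_def mult.assoc[symmetric] by simp_all
  have G1_nonneg: "0 \<le> G1" and A1_le: "A1 \<le> h0 * G1"
  proof -
    show "0 \<le> G1"
      by (rule has_integral_mono_AE[OF has_integral_0 G1]) (use g0 m x in \<open>auto elim!: eventually_mono\<close>)
    show "A1 \<le> h0 * G1"
      by (rule has_integral_mono_AE[OF A1 has_integral_mult_right[OF G1]])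
        (use g0 x hle in \<open>auto elim!: eventually_mono\<close>)
  qed
  have G2_nonneg: "0 \<le> G2" and A2_le: "A2 \<le> h0 * G2"
  proof -
    show "0 \<le> G2"
      by (rule has_integral_mono_AE[OF has_integral_0 G2]) (use g0 m x in \<open>auto elim!: eventually_mono\<close>)
    show "A2 \<le> h0 * G2"
      by (rule has_integral_mono_AE[OF A2 has_integral_mult_right[OF G2]])
        (use g0 x hle in \<open>auto elim!: eventually_mono\<close>)
  qed
  define B where "B = (sinh (m * L) - sinh (m * (L - x)) - sinh (m * x)) / m"
  define \<Phi> where "\<Phi> = sinh (m * (L - x)) * G1 + sinh (m * x) * G2"
  have B0: "0 \<le> B"
  proof -
    have "B = hinge_k L m x * (m * sinh (m * L))"
      using m L by (simp add: B_def hinge_k_def divide_simps power2_eq_square)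
    then show ?thesis
      using hinge_k_nonneg[OF x] sinh_mL_pos m by simp
  qed
  have B1: "B \<le> \<beta> * sinh (m * x)" and B2: "B \<le> \<beta> * sinh (m * (L - x))"
    using hinge_green_le[OF x] m by (simp_all add: B_def \<beta>_def divide_right_mono)
  \<comment> \<open>The weights in \<open>\<Phi>\<close> eliminate \<open>z3 x\<close>, and the
    addition theorem merges the coefficients of \<open>z2 x\<close> into
    \<open>sinh (m * L)\<close>.\<close>
  have rep: "- (m * sinh (m * L) * z2 x) = \<Phi> - N * J * B"
  proof -
    have "sinh (m * L) = sinh (m * x + m * (L - x))" by (simp add: algebra_simps)
    then have add: "sinh (m * L) = sinh (m * x) * cosh (m * (L - x)) + cosh (m * x) * sinh (m * (L - x))"
      by (simp only: sinh_add)
    show ?thesis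
      unfolding \<Phi>_def G1_def G2_def B_def add using m by (simp add: field_simps)
  qed
  \<comment> \<open>By \<open>rep\<close> it remains to show that \<open>N * J * B\<close> is at
    most \<open>\<Phi>\<close>. Here \<open>J\<close> is accessible only through
    \<open>J * (1 + N * H) = A1 + A2\<close>, hence the multiplication by \<open>1 + N * H\<close>,
    which \<open>corner\<close> allows to be cancelled at the end.\<close>
  have \<Phi>0: "0 \<le> \<Phi>"
    unfolding \<Phi>_def using G1_nonneg G2_nonneg m x by simp
  have "(1 + N * H) * (N * J * B) = N * B * (A1 + A2)"
    by (simp add: AJ algebra_simps)
  also have "\<dots> \<le> N * B * (h0 * (G1 + G2))"
    using A1_le A2_le N B0 by (intro mult_left_mono) (auto simp: algebra_simps)
  also have "\<dots> = N * h0 * (B * G1 + B * G2)"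
    by (simp add: algebra_simps)
  also have "\<dots> \<le> N * h0 * (\<beta> * sinh (m * (L - x)) * G1 + \<beta> * sinh (m * x) * G2)"
    using B1 B2 G1_nonneg G2_nonneg N h00 by (intro mult_left_mono add_mono mult_right_mono) auto
  also have "\<dots> = (N * h0 * \<beta>) * \<Phi>"
    by (simp add: \<Phi>_def algebra_simps)
  also have "\<dots> \<le> (1 + N * H) * \<Phi>"
    using corner \<Phi>0 by (rule mult_right_mono)
  finally have "N * J * B \<le> \<Phi>"
    using N H0 by (simp add: add_pos_nonneg)
  with rep have "m * sinh (m * L) * z2 x \<le> 0" by linarith
  then show ?thesis
    using m L by (auto simp: mult_le_0_iff)
qed

end

subsection \<open>Solvability and comparison\<close>

lemma navier_diff:
  assumes "navier L z z2 z4" "navier L w w2 w4" "0 \<le> L"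
  shows "navier L (\<lambda>x. w x - z x) (\<lambda>x. w2 x - z2 x) (\<lambda>x. w4 x - z4 x)"
  using navier_add_mult[OF assms(2,1,3), of "-1"] by simp

lemma C2_onE:
  assumes "C2_on L u u2"
  obtains u1 where
    "\<And>x. x \<in> {0..L} \<Longrightarrow> (u has_real_derivative u1 x) (at x within {0..L})"
    "\<And>x. x \<in> {0..L} \<Longrightarrow> (u1 has_real_derivative u2 x) (at x within {0..L})"
    "continuous_on {0..L} u" "continuous_on {0..L} u2"
  using assms continuous_on_DERIV_within unfolding C2_on_def by metis

lemma dirichlet_exists:
  assumes L: "0 < L" and g: "continuous_on {0..L} g"
  shows "\<exists>z. C2_on L z g \<and> z 0 = 0 \<and> z L = (0::real)"
proof -
  define G where "G x = integral {0..x} g" for x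
  define F where "F x = integral {0..x} G" for x
  have G: "(G has_real_derivative g x) (at x within {0..L})" if "x \<in> {0..L}" for x
    unfolding G_def using g that by (rule integral_has_real_derivative)
  have F: "(F has_real_derivative G x) (at x within {0..L})" if "x \<in> {0..L}" for x
    unfolding F_def using continuous_on_DERIV_within[OF G] that by (rule integral_has_real_derivative)
  have "C2_on L (\<lambda>x. F x - F L / L * x) g"
    unfolding C2_on_def
  proof (intro exI conjI ballI)
    fix x assume x: "x \<in> {0..L}"
    show "((\<lambda>x. F x - F L / L * x) has_real_derivative G x - F L / L) (at x within {0..L})"
      by (intro DERIV_diff F x DERIV_cmult_Id)
    show "((\<lambda>x. G x - F L / L) has_real_derivative g x) (at x within {0..L})"
      using DERIV_diff[OF G[OF x] DERIV_const] by simp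
  qed (rule g)
  moreover have "F 0 = 0" by (simp add: F_def)
  ultimately show ?thesis
    using L by (intro exI[of _ "\<lambda>x. F x - F L / L * x"]) simp
qed

text \<open>The order interval, the iteration and the notion of solution each quantify over their
  own second derivative; this identifies the witnesses. One-sided derivatives at the end points are
  unique because the interval is nondegenerate.\<close>

lemma C2_on_unique:
  assumes L: "0 < L" and u: "C2_on L u u2" "C2_on L u v2" and x: "x \<in> {0..L}"
  shows "u2 x = v2 x"
proof -
  obtain u1 where u1: "\<And>x. x \<in> {0..L} \<Longrightarrow> (u has_real_derivative u1 x) (at x within {0..L})"
    "\<And>x. x \<in> {0..L} \<Longrightarrow> (u1 has_real_derivative u2 x) (at x within {0..L})"
    using u(1) by (metis C2_onE)
  obtain v1 where v1: "\<And>x. x \<in> {0..L} \<Longrightarrow> (u has_real_derivative v1 x) (at x within {0..L})"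
    "\<And>x. x \<in> {0..L} \<Longrightarrow> (v1 has_real_derivative v2 x) (at x within {0..L})"
    using u(2) by (metis C2_onE)
  have uniq: "d = e" if "(f has_real_derivative d) (at y within {0..L})"
    "(f has_real_derivative e) (at y within {0..L})" "y \<in> {0..L}" for f :: "real \<Rightarrow> real" and d e y
    using vector_derivative_unique_within_closed_interval[of 0 L y f d e] L that
    by (simp add: has_real_derivative_iff_has_vector_derivative)
  have "u1 y = v1 y" if "y \<in> {0..L}" for y
    using uniq u1(1) v1(1) that by blast
  then have "(u1 has_real_derivative v2 x) (at x within {0..L})"
    using has_field_derivative_transform_within[OF v1(2)[OF x] zero_less_one x] by metis
  then show ?thesis using uniq u1(2)[OF x] x by blast
qed

lemma C2_on_diff:
  assumes "C2_on L w w2" "C2_on L u u2"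
  shows "C2_on L (\<lambda>x. w x - u x) (\<lambda>x. w2 x - u2 x)"
proof -
  obtain u1 where u1: "\<And>x. x \<in> {0..L} \<Longrightarrow> (u has_real_derivative u1 x) (at x within {0..L})"
    "\<And>x. x \<in> {0..L} \<Longrightarrow> (u1 has_real_derivative u2 x) (at x within {0..L})" "continuous_on {0..L} u2"
    using assms(2) by (metis C2_onE)
  obtain w1 where w1: "\<And>x. x \<in> {0..L} \<Longrightarrow> (w has_real_derivative w1 x) (at x within {0..L})"
    "\<And>x. x \<in> {0..L} \<Longrightarrow> (w1 has_real_derivative w2 x) (at x within {0..L})" "continuous_on {0..L} w2"
    using assms(1) by (metis C2_onE)
  show ?thesis
    unfolding C2_on_def
    by (intro exI[of _ "\<lambda>x. w1 x - u1 x"] conjI ballI DERIV_diff u1 w1 continuous_intros)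
qed

lemma dirichlet_comparison:
  assumes u: "C2_on L u u2" and w: "C2_on L w w2"
    and ends: "u 0 \<le> w 0" "u L \<le> w L" and le: "\<And>x. x \<in> {0..L} \<Longrightarrow> w2 x \<le> u2 x"
    and x: "x \<in> {0..L}"
  shows "u x \<le> w x"
proof -
  obtain u1 where u1: "\<And>x. x \<in> {0..L} \<Longrightarrow> (u has_real_derivative u1 x) (at x within {0..L})"
    "\<And>x. x \<in> {0..L} \<Longrightarrow> (u1 has_real_derivative u2 x) (at x within {0..L})"
    using u by (metis C2_onE)
  obtain w1 where w1: "\<And>x. x \<in> {0..L} \<Longrightarrow> (w has_real_derivative w1 x) (at x within {0..L})"
    "\<And>x. x \<in> {0..L} \<Longrightarrow> (w1 has_real_derivative w2 x) (at x within {0..L})"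
    using w by (metis C2_onE)
  have "u x - w x \<le> 0"
    by (rule nonpos_if_second_derivative_nonneg[where f = "\<lambda>x. u x - w x",
          OF DERIV_diff[OF u1(1) w1(1)] DERIV_diff[OF u1(2) w1(2)] _ _ _ x])
      (use ends le in auto)
  then show ?thesis by simp
qed

text \<open>A concave function vanishing at both ends lies above \<open>z x s (L - s) / L\<^sup>2\<close>, by comparison with
  its two chords at \<open>x\<close>.\<close>
lemma concave_ge_parabola:
  assumes L: "0 < L" and z: "C2_on L z z2" "z 0 = 0" "z L = 0"
    and z2: "\<And>x. x \<in> {0..L} \<Longrightarrow> z2 x \<le> 0" and x: "x \<in> {0..L}" and s: "s \<in> {0..L}"
  shows "z x / L\<^sup>2 * (s * (L - s)) \<le> z s"
proof -
  obtain z1 where z1: "\<And>x. x \<in> {0..L} \<Longrightarrow> (z has_real_derivative z1 x) (at x within {0..L})"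
    "\<And>x. x \<in> {0..L} \<Longrightarrow> (z1 has_real_derivative z2 x) (at x within {0..L})"
    using z(1) by (metis C2_onE)
  have "C2_on L (\<lambda>_. 0) (\<lambda>_. 0)"
    unfolding C2_on_def by (intro exI[of _ "\<lambda>_. 0"]) auto
  from dirichlet_comparison[OF this z(1)] z z2 x have zx: "0 \<le> z x" by auto
  have chord: "r + q * s \<le> z s"
    if "0 \<le> u" "v \<le> L" "s \<in> {u..v}" "r + q * u \<le> z u" "r + q * v \<le> z v" for u v s r q
  proof -
    have d: "(f has_real_derivative f' y) (at y within {u..v})"
      if "\<And>x. x \<in> {0..L} \<Longrightarrow> (f has_real_derivative f' x) (at x within {0..L})" "y \<in> {u..v}" for f f' y
      using that(1)[of y] that(2) \<open>0 \<le> u\<close> \<open>v \<le> L\<close> by (force intro: DERIV_subset)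
    have "((\<lambda>s. r + q * s) has_real_derivative q) (at y within {u..v})" for y
      by (auto intro!: derivative_eq_intros)
    from DERIV_diff[OF this d[OF z1(1)]]
    have "((\<lambda>s. r + q * s - z s) has_real_derivative q - z1 y) (at y within {u..v})" if "y \<in> {u..v}" for y
      using that by blast
    moreover from DERIV_diff[OF DERIV_const d[OF z1(2)]]
    have "((\<lambda>s. q - z1 s) has_real_derivative 0 - z2 y) (at y within {u..v})" if "y \<in> {u..v}" for y
      using that by blast
    ultimately have "r + q * s - z s \<le> 0"
      by (rule nonpos_if_second_derivative_nonneg) (use that z2 in auto)
    then show ?thesis by simp
  qed
  show ?thesis
  proof (cases "s \<le> x")
    case True
    have "z x / L\<^sup>2 * (s * (L - s)) \<le> z x / L\<^sup>2 * (s * L)"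
      using zx s by (intro mult_left_mono) auto
    also have "\<dots> = 0 + z x / L * s" using L by (simp add: power2_eq_square)
    also have "\<dots> \<le> z s"
      by (rule chord[of 0 x]) (use True s x z zx L in \<open>auto simp: divide_simps mult_left_mono\<close>)
    finally show ?thesis .
  next
    case False
    have "z x / L\<^sup>2 * (s * (L - s)) \<le> z x / L\<^sup>2 * (L * (L - s))"
      using zx s by (intro mult_left_mono mult_right_mono) auto
    also have "\<dots> = z x + - z x / L * s" using L by (simp add: power2_eq_square field_simps)
    also have "\<dots> \<le> z s"
      by (rule chord[of x L]) (use False s x z zx L in \<open>auto simp: divide_simps mult_left_mono\<close>)
    finally show ?thesis .
  qed
qed

text \<open>Integrating the parabola bound over \<open>s\<close> yields this, with
  \<open>6 / L\<close> being \<open>L\<^sup>2\<close> divided by the integral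
  \<open>L ^ 3 / 6\<close> of \<open>s * (L - s)\<close>. It upgrades decay of integrals to uniform
  decay.\<close>

lemma concave_le_integral:
  assumes L: "0 < L" and z: "C2_on L z z2" "z 0 = 0" "z L = 0"
    and z2: "\<And>x. x \<in> {0..L} \<Longrightarrow> z2 x \<le> 0" and x: "x \<in> {0..L}"
  shows "z x \<le> 6 / L * integral {0..L} z"
proof -
  have zc: "continuous_on {0..L} z" using z(1) by (metis C2_onE)
  have "((\<lambda>s. s * (L - s)) has_integral ((\<lambda>s. L * s\<^sup>2 / 2 - s ^ 3 / 3) L - (\<lambda>s. L * s\<^sup>2 / 2 - s ^ 3 / 3) 0)) {0..L}"
    by (rule has_integral_derivative) (use L in \<open>auto intro!: derivative_eq_intros simp: field_simps power2_eq_square\<close>)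
  then have "((\<lambda>s. s * (L - s)) has_integral L ^ 3 / 6) {0..L}"
    by (simp add: power2_eq_square power3_eq_cube mult_ac)
  from has_integral_le[OF has_integral_mult_right[OF this] integrable_integral[OF integrable_continuous_real[OF zc]] concave_ge_parabola[OF L z z2 x]]
  have "z x / L\<^sup>2 * (L ^ 3 / 6) \<le> integral {0..L} z" .
  then show ?thesis using L by (simp add: field_simps power2_eq_square power3_eq_cube)
qed

section \<open>Solvability and comparison for the linear nonlocal problem\<close>

context
  fixes L m :: real
  assumes L: "0 < L" and m: "0 < m"
begin

text \<open>The substitution \<open>z'' = \<zeta> + Q\<close> with \<open>Q'' = f\<close> moves the merely integrable right-hand side into a
  continuous one, for which variation of constants applies.\<close>
lemma navier_exists_local:
  assumes f: "f absolutely_integrable_on {0..L}"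
  shows "\<exists>z z2 z4. navier L z z2 z4 \<and> (\<forall>x. z4 x - m\<^sup>2 * z2 x = f x)"
proof -
  have fi: "f integrable_on {0..L}" using f by (simp add: absolutely_integrable_on_def)
  define R where "R x = integral {0..x} f" for x
  define Q where "Q x = integral {0..x} R" for x
  have Rc: "continuous_on {0..L} R"
    unfolding R_def by (rule indefinite_integral_continuous_1[OF fi])
  have Q: "(Q has_real_derivative R x) (at x within {0..L})" if "x \<in> {0..L}" for x
    unfolding Q_def using Rc that by (rule integral_has_real_derivative)
  have Qc: "continuous_on {0..L} Q" using Q by (rule continuous_on_DERIV_within)
  define C where "C x = integral {0..x} (\<lambda>s. cosh (m * s) * (m\<^sup>2 * Q s))" for x
  define S where "S x = integral {0..x} (\<lambda>s. sinh (m * s) * (m\<^sup>2 * Q s))" for x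
  have C: "(C has_real_derivative cosh (m * x) * (m\<^sup>2 * Q x)) (at x within {0..L})" if "x \<in> {0..L}" for x
    unfolding C_def by (rule integral_has_real_derivative[OF _ that]) (intro continuous_intros Qc)
  have S: "(S has_real_derivative sinh (m * x) * (m\<^sup>2 * Q x)) (at x within {0..L})" if "x \<in> {0..L}" for x
    unfolding S_def by (rule integral_has_real_derivative[OF _ that]) (intro continuous_intros Qc)
  \<comment> \<open>Variation of constants for \<zeta>'' = \<open>m\<^sup>2 * (\<zeta> + Q)\<close>
    with zero data at \<open>0\<close>; the multiple \<open>\<alpha>\<close> of
    \<open>sinh (m * x)\<close> then enforces \<open>z2 L = 0\<close>.\<close>
  define \<zeta> where "\<zeta> x = (sinh (m * x) * C x - cosh (m * x) * S x) / m" for x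
  define \<alpha> where "\<alpha> = - (\<zeta> L + Q L) / sinh (m * L)"
  define z2 where "z2 x = \<alpha> * sinh (m * x) + \<zeta> x + Q x" for x
  define y3 where "y3 x = \<alpha> * m * cosh (m * x) + (cosh (m * x) * C x - sinh (m * x) * S x)" for x
  have sh: "((\<lambda>x. sinh (m * x)) has_real_derivative m * cosh (m * x)) (at x within {0..L})"
    and ch: "((\<lambda>x. cosh (m * x)) has_real_derivative m * sinh (m * x)) (at x within {0..L})" for x
    by (auto intro!: derivative_eq_intros)
  have z2: "(z2 has_real_derivative y3 x + R x) (at x within {0..L})" if x: "x \<in> {0..L}" for x
    unfolding z2_def \<zeta>_def
    by (rule DERIV_cong[OF DERIV_add[OF DERIV_add[OF DERIV_cmult[OF sh] DERIV_cdivide[OF DERIV_diff[OF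
              DERIV_mult[OF sh C[OF x]] DERIV_mult[OF ch S[OF x]]]]] Q[OF x]]])
      (use m in \<open>simp add: y3_def field_simps\<close>)
  have y3: "(y3 has_real_derivative m\<^sup>2 * z2 x) (at x within {0..L})" if x: "x \<in> {0..L}" for x
  proof -
    have "cosh (m * x) * (cosh (m * x) * (m\<^sup>2 * Q x)) - sinh (m * x) * (sinh (m * x) * (m\<^sup>2 * Q x))
        = ((cosh (m * x))\<^sup>2 - (sinh (m * x))\<^sup>2) * (m\<^sup>2 * Q x)"
      by (simp add: algebra_simps power2_eq_square)
    also have "\<dots> = m\<^sup>2 * Q x" by (simp add: hyperbolic_pythagoras)
    finally have p: "cosh (m * x) * (cosh (m * x) * (m\<^sup>2 * Q x)) - sinh (m * x) * (sinh (m * x) * (m\<^sup>2 * Q x)) = m\<^sup>2 * Q x" .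
    show ?thesis
      unfolding y3_def
      by (rule DERIV_cong[OF DERIV_add[OF DERIV_cmult[OF ch] DERIV_diff[OF
              DERIV_mult[OF ch C[OF x]] DERIV_mult[OF sh S[OF x]]]]])
        (use m p in \<open>simp add: z2_def \<zeta>_def field_simps power2_eq_square\<close>)
  qed
  have z2c: "continuous_on {0..L} z2" using z2 by (rule continuous_on_DERIV_within)
  have ends: "z2 0 = 0" "z2 L = 0"
    using L m by (simp_all add: z2_def \<alpha>_def \<zeta>_def C_def S_def Q_def)
  obtain z where z: "C2_on L z z2" "z 0 = 0" "z L = 0"
    using dirichlet_exists[OF L z2c] by blast
  define z4 where "z4 x = m\<^sup>2 * z2 x + f x" for x
  have z4: "z4 absolutely_integrable_on {0..L}"
    unfolding z4_def
    by (intro set_integral_add f absolutely_integrable_continuous_real continuous_intros z2c)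
  have z3: "y3 x + R x = y3 0 + R 0 + integral {0..x} z4" if x: "x \<in> {0..L}" for x
  proof -
    have "((\<lambda>x. m\<^sup>2 * z2 x) has_integral (y3 x - y3 0)) {0..x}"
    proof (rule has_integral_derivative)
      show "(y3 has_real_derivative m\<^sup>2 * z2 s) (at s within {0..x})" if "s \<in> {0..x}" for s
        using y3[of s] that x by (force intro: DERIV_subset)
    qed (use x in auto)
    moreover have "(f has_integral R x) {0..x}"
      unfolding R_def using x by (auto intro!: integrable_integral integrable_subinterval_real[OF fi])
    ultimately have "(z4 has_integral (y3 x - y3 0 + R x)) {0..x}"
      unfolding z4_def by (rule has_integral_add)
    then show ?thesis by (simp add: integral_unique R_def)
  qed
  have "navier L z z2 z4"
    unfolding navier_def W41_on_def
    using z z4 ends by (intro conjI exI[of _ "\<lambda>x. y3 x + R x"] ballI z2 z3)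
  then show ?thesis by (intro exI conjI) (auto simp: z4_def)
qed

lemma navier_hinge: "navier L (hinge_h L m) (\<lambda>s. - hinge_k L m s) (\<lambda>s. 1 - m\<^sup>2 * hinge_k L m s)"
proof -
  note d = hinge_h_derivatives[OF L m]
  have kc: "continuous_on S (hinge_k L m)" for S
    using continuous_on_minus[OF continuous_on_DERIV_within[OF d(3), of S]] by simp
  show ?thesis
  proof (rule navierI[OF _ d(1-3)])
    show "(\<lambda>s. 1 - m\<^sup>2 * hinge_k L m s) absolutely_integrable_on {0..L}"
      by (intro absolutely_integrable_continuous_real continuous_intros kc)
    show "hinge_h3 L m x = hinge_h3 L m 0 + integral {0..x} (\<lambda>s. 1 - m\<^sup>2 * hinge_k L m s)" if "x \<in> {0..L}" for x
      using integral_unique[OF has_integral_derivative[OF _ d(4), of 0 x]] that by simp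
  qed (use L m in \<open>auto simp: hinge_ends\<close>)
qed

text \<open>The nonlocal term is a constant, and \<open>hinge_h\<close> is the response to the
  constant 1. Adding \<open>r\<close> times it to a solution of the local problem leaves one scalar
  equation \<open>r + N * (I + r * H) = 0\<close>, solvable since \<open>1 + N * H\<close> is
  positive.\<close>

lemma navier_exists:
  assumes f: "f absolutely_integrable_on {0..L}" and N: "0 \<le> N"
  shows "\<exists>z z2 z4. navier L z z2 z4 \<and> (\<forall>x. z4 x - m\<^sup>2 * z2 x + N * integral {0..L} z = f x)"
proof -
  obtain y y2 y4 where y: "navier L y y2 y4" "\<And>x. y4 x - m\<^sup>2 * y2 x = f x"
    using navier_exists_local[OF f] by blast
  define H where "H = integral {0..L} (hinge_h L m)"
  have H: "0 \<le> H" unfolding H_def by (rule hinge_h_integral_nonneg[OF L m])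
  define I where "I = integral {0..L} y"
  define r where "r = - (N * I / (1 + N * H))"
  have z: "navier L (\<lambda>x. y x + r * hinge_h L m x) (\<lambda>x. y2 x + r * - hinge_k L m x)
      (\<lambda>x. y4 x + r * (1 - m\<^sup>2 * hinge_k L m x))"
    by (rule navier_add_mult[OF y(1) navier_hinge]) (use L in simp)
  have "integral {0..L} (\<lambda>x. y x + r * hinge_h L m x) = I + r * H"
    unfolding I_def H_def
    using navier_continuous[OF y(1)] navier_continuous[OF navier_hinge]
    by (subst Henstock_Kurzweil_Integration.integral_add) (auto intro!: integrable_continuous_real continuous_intros)
  moreover have "N * (I + r * H) = - r"
  proof -
    have "1 + N * H \<noteq> 0" using N H by (smt (verit) mult_nonneg_nonneg)
    then show ?thesis unfolding r_def by (simp add: divide_simps) (simp add: algebra_simps)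
  qed
  ultimately have "y4 x + r * (1 - m\<^sup>2 * hinge_k L m x) - m\<^sup>2 * (y2 x + r * - hinge_k L m x)
      + N * integral {0..L} (\<lambda>x. y x + r * hinge_h L m x) = f x" for x
    using y(2)[of x] by (simp add: algebra_simps)
  with z show ?thesis by blast
qed

lemma navier_comparison:
  assumes N: "0 < N" and cond: "N \<le> 4 * m\<^sup>2 / L ^ 3 * sigma5 (m * L)"
    and z: "navier L z z2 z4" and w: "navier L w w2 w4"
    and le: "AE x in lebesgue. x \<in> {0<..<L} \<longrightarrow>
      z4 x - m\<^sup>2 * z2 x + N * integral {0..L} z \<le> w4 x - m\<^sup>2 * w2 x + N * integral {0..L} w"
    and x: "x \<in> {0..L}"
  shows "z x \<le> w x" "w2 x \<le> z2 x"
proof -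
  have d: "navier L (\<lambda>x. w x - z x) (\<lambda>x. w2 x - z2 x) (\<lambda>x. w4 x - z4 x)"
    by (rule navier_diff[OF z w less_imp_le[OF L]])
  have I: "integral {0..L} (\<lambda>x. w x - z x) = integral {0..L} w - integral {0..L} z"
    using navier_continuous[OF z] navier_continuous[OF w]
    by (subst Henstock_Kurzweil_Integration.integral_diff) (auto intro!: integrable_continuous_real continuous_intros)
  have w2z2: "w2 x \<le> z2 x" if "x \<in> {0..L}" for x
  proof -
    have "w2 x - z2 x \<le> 0"
    proof (rule navier_maximum_principle[OF L m N cond d _ that])
      show "AE x in lebesgue. x \<in> {0<..<L} \<longrightarrow> 0 \<le> w4 x - z4 x - m\<^sup>2 * (w2 x - z2 x)
          + N * integral {0..L} (\<lambda>x. w x - z x)"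
        unfolding I using le by eventually_elim (auto simp: algebra_simps)
    qed
    then show ?thesis by simp
  qed
  show "w2 x \<le> z2 x" using w2z2 x .
  show "z x \<le> w x"
    using dirichlet_comparison[of L z z2 w w2] z w w2z2 x by (auto simp: navier_def W41_on_def)
qed

end

subsection \<open>The monotone iteration\<close>

locale beam =
  fixes L a b c lam :: real and p :: "real \<Rightarrow> real"
  assumes L: "L > 0" and a: "a > 0" and b: "b > 0" and c: "c > 0" and lam: "lam > 0"
    and p_int: "p absolutely_integrable_on {0..L}"
    and p_nonneg: "AE x in lebesgue. x \<in> {0..L} \<longrightarrow> 0 \<le> p x"
    and p_bound: "AE x in lebesgue. x \<in> {0..L} \<longrightarrow>
        p x \<le> (lam * pi ^ 4 / L ^ 4 + a * lam * pi ^ 2 / L ^ 2 + 2 * b * lam ^ 2 * pi / L)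
                 * sin (pi * x / L) + 2 * lam * c * L / pi"
    and MN: "c + b * lam * pi ^ 2 / L ^ 2
        \<le> 4 * (a + 2 * b * lam * L / pi) / L ^ 3 * sigma5 (sqrt (a + 2 * b * lam * L / pi) * L)"
begin

text \<open>This is b times the integral of \<lambda> sin(\<pi> x / L), the largest b times integral
  of u on the order interval.\<close>

definition Q :: real where "Q = 2 * b * lam * L / pi"
text \<open>This is b times the maximum of \<lambda> (\<pi>/L)^2 sin(\<pi> x / L), a bound for -b
  u'' on the order interval.\<close>

definition \<kappa> :: real where "\<kappa> = b * lam * pi ^ 2 / L ^ 2"

definition rhs :: "(real \<Rightarrow> real) \<Rightarrow> (real \<Rightarrow> real) \<Rightarrow> real \<Rightarrow> real" where
  "rhs u u2 x = p x + b * u2 x * integral {0..L} u - Q * u2 x + \<kappa> * integral {0..L} u"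

definition step :: "(real \<Rightarrow> real) \<Rightarrow> (real \<Rightarrow> real) \<Rightarrow> (real \<Rightarrow> real) \<Rightarrow> (real \<Rightarrow> real) \<Rightarrow> bool" where
  "step u u2 y y2 \<longleftrightarrow> (\<exists>y4. navier L y y2 y4 \<and> (AE x in lebesgue. x \<in> {0<..<L} \<longrightarrow>
     y4 x - (a + Q) * y2 x + (c + \<kappa>) * integral {0..L} y = rhs u u2 x))"

definition inK :: "(real \<Rightarrow> real) \<Rightarrow> (real \<Rightarrow> real) \<Rightarrow> bool" where
  "inK u u2 \<longleftrightarrow> C2_on L u u2 \<and> (\<forall>x\<in>{0..L}. 0 \<le> u x \<and> u x \<le> lam * sin (pi / L * x)
     \<and> u2 x \<le> 0 \<and> - lam * (pi / L) ^ 2 * sin (pi / L * x) \<le> u2 x)"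

text \<open>The clause on second derivatives belongs to the order because \<open>rhs\<close> depends
  on \<open>u2\<close> pointwise and not only on the integral of \<open>u\<close>.\<close>

definition ord :: "(real \<Rightarrow> real) \<Rightarrow> (real \<Rightarrow> real) \<Rightarrow> (real \<Rightarrow> real) \<Rightarrow> (real \<Rightarrow> real) \<Rightarrow> bool" where
  "ord u u2 w w2 \<longleftrightarrow> (\<forall>x\<in>{0..L}. u x \<le> w x \<and> w2 x \<le> u2 x)"

definition chain :: "(nat \<Rightarrow> real \<Rightarrow> real) \<Rightarrow> (nat \<Rightarrow> real \<Rightarrow> real) \<Rightarrow> bool" where
  "chain y y2 \<longleftrightarrow> (\<forall>n. step (y n) (y2 n) (y (Suc n)) (y2 (Suc n)))"

lemma iter_seq_iff: "iter_seq L a b c lam p y \<longleftrightarrow> (\<exists>y2. C2_on L (y 0) (y2 0) \<and> chain y y2)"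
  by (simp add: iter_seq_def Let_def chain_def step_def navier_def rhs_def Q_def \<kappa>_def)

lemma setK_iff: "setK L lam u \<longleftrightarrow> (\<exists>u2. inK u u2)"
  by (simp add: setK_def inK_def)

text \<open>On a fixed point the shifts by \<open>Q\<close> and \<open>\<kappa>\<close> on the two
  sides of the equation cancel.\<close>

lemma solves_P_iff: "solves_P L a b c p v \<longleftrightarrow> (\<exists>v2. step v v2 v v2)"
proof -
  have "(v4 x - (a + b * I) * v2 x + c * I = p x) \<longleftrightarrow>
    (v4 x - (a + Q) * v2 x + (c + \<kappa>) * I = p x + b * v2 x * I - Q * v2 x + \<kappa> * I)" for v2 v4 I x
    by (auto simp: algebra_simps)
  then show ?thesis
    by (simp add: solves_P_def step_def navier_def rhs_def)
qed

lemma Q_pos: "0 < Q" and \<kappa>_pos: "0 < \<kappa>"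
  using b lam L by (auto simp: Q_def \<kappa>_def)

lemma comparison:
  assumes "navier L z z2 z4" "navier L w w2 w4"
    and "AE x in lebesgue. x \<in> {0<..<L} \<longrightarrow> z4 x - (a + Q) * z2 x + (c + \<kappa>) * integral {0..L} z
      \<le> w4 x - (a + Q) * w2 x + (c + \<kappa>) * integral {0..L} w"
  shows "ord z z2 w w2"
proof -
  have sq: "(sqrt (a + Q))\<^sup>2 = a + Q" and m: "0 < sqrt (a + Q)"
    using a Q_pos by auto
  have "c + \<kappa> \<le> 4 * (sqrt (a + Q))\<^sup>2 / L ^ 3 * sigma5 (sqrt (a + Q) * L)"
    using MN unfolding sq by (simp add: Q_def \<kappa>_def)
  from navier_comparison[OF L m _ this assms(1,2)] assms(3) show ?thesis
    using c \<kappa>_pos unfolding sq ord_def by auto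
qed

lemma inK_C2: "inK u u2 \<Longrightarrow> C2_on L u u2"
  by (simp add: inK_def)

lemma inK_cont: "inK u u2 \<Longrightarrow> continuous_on {0..L} u" "inK u u2 \<Longrightarrow> continuous_on {0..L} u2"
  using inK_C2 by (metis C2_onE)+

lemma inK_ends: assumes "inK u u2" shows "u 0 = 0" "u L = 0"
proof -
  have "0 \<le> u 0" "u 0 \<le> lam * sin (pi / L * 0)" "0 \<le> u L" "u L \<le> lam * sin (pi / L * L)"
    using bspec[OF conjunct2[OF assms[unfolded inK_def]], of 0]
      bspec[OF conjunct2[OF assms[unfolded inK_def]], of L] L by auto
  then show "u 0 = 0" "u L = 0" using L by auto
qed

lemma sin_nonneg: "x \<in> {0..L} \<Longrightarrow> 0 \<le> sin (pi / L * x)"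
  using L by (intro sin_ge_zero) (auto simp: field_simps)

lemma sine_has_integral: "((\<lambda>x. lam * sin (pi / L * x)) has_integral 2 * lam * L / pi) {0..L}"
proof -
  have "((\<lambda>x. lam * sin (pi / L * x)) has_integral
      ((\<lambda>x. - lam * L / pi * cos (pi / L * x)) L - (\<lambda>x. - lam * L / pi * cos (pi / L * x)) 0)) {0..L}"
    by (rule has_integral_derivative) (use L in \<open>auto intro!: derivative_eq_intros\<close>)
  then show ?thesis using L by (simp add: mult_ac)
qed

lemma inK_integral:
  assumes "inK u u2"
  shows "0 \<le> integral {0..L} u" "b * integral {0..L} u \<le> Q"
proof -
  have i: "u integrable_on {0..L}" by (intro integrable_continuous_real inK_cont[OF assms])
  show "0 \<le> integral {0..L} u"
    using assms i unfolding inK_def by (intro integral_nonneg) auto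
  have "integral {0..L} u \<le> 2 * lam * L / pi"
    using assms by (intro has_integral_le[OF integrable_integral[OF i] sine_has_integral]) (auto simp: inK_def)
  then have "b * integral {0..L} u \<le> b * (2 * lam * L / pi)"
    using b by (intro mult_left_mono) auto
  then show "b * integral {0..L} u \<le> Q" by (simp add: Q_def mult_ac)
qed

lemma inK_second:
  assumes "inK u u2" "x \<in> {0..L}"
  shows "0 \<le> b * u2 x + \<kappa>"
proof -
  have "lam * (pi / L)\<^sup>2 * sin (pi / L * x) \<le> lam * (pi / L)\<^sup>2 * 1"
    using lam by (intro mult_left_mono) auto
  then have "- (lam * (pi / L)\<^sup>2) \<le> u2 x"
    using assms unfolding inK_def by fastforce
  then have "b * (- (lam * (pi / L)\<^sup>2)) \<le> b * u2 x" using b by (intro mult_left_mono) auto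
  then show ?thesis by (simp add: \<kappa>_def power_divide)
qed

lemma ord_integral:
  assumes "ord u u2 w w2" "continuous_on {0..L} u" "continuous_on {0..L} w"
  shows "integral {0..L} u \<le> integral {0..L} w"
  using assms by (intro integral_le integrable_continuous_real) (auto simp: ord_def)

text \<open>The increment of \<open>rhs\<close> is \<open>(u2 - w2)\<close> times \<open>Q\<close>
  minus b times the integral of \<open>w\<close>, plus the difference of the integrals times
  \<open>b * u2 + \<kappa>\<close>. All factors are nonnegative by the choice of \<open>Q\<close>
  and \<open>\<kappa>\<close>. The upper bound discards the change of the product term, which is
  nonpositive.\<close>

lemma rhs_mono:
  assumes u: "inK u u2" and w: "inK w w2" and le: "ord u u2 w w2" and x: "x \<in> {0..L}"
  shows "rhs u u2 x \<le> rhs w w2 x"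
    and "rhs w w2 x - rhs u u2 x \<le> Q * (u2 x - w2 x) + \<kappa> * (integral {0..L} w - integral {0..L} u)"
proof -
  have I: "integral {0..L} u \<le> integral {0..L} w"
    using ord_integral[OF le] inK_cont u w by blast
  have w2: "w2 x \<le> u2 x" using le x by (auto simp: ord_def)
  have "0 \<le> (u2 x - w2 x) * (Q - b * integral {0..L} w)
      + (integral {0..L} w - integral {0..L} u) * (b * u2 x + \<kappa>)"
    using mult_nonneg_nonneg[of "u2 x - w2 x" "Q - b * integral {0..L} w"] inK_integral[OF w] w2
      mult_nonneg_nonneg[OF _ inK_second[OF u x], of "integral {0..L} w - integral {0..L} u"] I by simp
  then show "rhs u u2 x \<le> rhs w w2 x"
    by (simp add: rhs_def algebra_simps)
  have "u2 x \<le> 0" using u x by (auto simp: inK_def)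
  then have "0 \<le> b * ((u2 x - w2 x) * integral {0..L} w + (- u2 x) * (integral {0..L} w - integral {0..L} u))"
    using I w2 inK_integral[OF w] b by (intro mult_nonneg_nonneg add_nonneg_nonneg) auto
  then show "rhs w w2 x - rhs u u2 x \<le> Q * (u2 x - w2 x) + \<kappa> * (integral {0..L} w - integral {0..L} u)"
    by (simp add: rhs_def algebra_simps)
qed

section \<open>Monotonicity of one step and invariance of the order interval\<close>

lemma step_exists:
  assumes "C2_on L u u2"
  shows "\<exists>y y2. step u u2 y y2"
proof -
  have u2c: "continuous_on {0..L} u2" using assms by (metis C2_onE)
  have sq: "(sqrt (a + Q))\<^sup>2 = a + Q" and m: "0 < sqrt (a + Q)"
    using a Q_pos by auto
  define g where "g x = b * u2 x * integral {0..L} u - Q * u2 x + \<kappa> * integral {0..L} u" for x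
  have "(\<lambda>x. p x + g x) absolutely_integrable_on {0..L}"
    unfolding g_def
    by (intro set_integral_add(1) p_int absolutely_integrable_continuous_real continuous_intros u2c)
  moreover have "rhs u u2 = (\<lambda>x. p x + g x)"
    by (simp add: fun_eq_iff rhs_def g_def)
  ultimately have "rhs u u2 absolutely_integrable_on {0..L}" by simp
  from navier_exists[OF L m this, of "c + \<kappa>"] show ?thesis
    using c \<kappa>_pos unfolding sq step_def by fastforce
qed

lemma step_mono:
  assumes "inK u u2" "inK w w2" "ord u u2 w w2" "step u u2 y y2" "step w w2 v v2"
  shows "ord y y2 v v2"
proof -
  obtain y4 where y: "navier L y y2 y4" "AE x in lebesgue. x \<in> {0<..<L} \<longrightarrow>
     y4 x - (a + Q) * y2 x + (c + \<kappa>) * integral {0..L} y = rhs u u2 x"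
    using assms(4) unfolding step_def by blast
  obtain v4 where v: "navier L v v2 v4" "AE x in lebesgue. x \<in> {0<..<L} \<longrightarrow>
     v4 x - (a + Q) * v2 x + (c + \<kappa>) * integral {0..L} v = rhs w w2 x"
    using assms(5) unfolding step_def by blast
  show ?thesis
  proof (rule comparison[OF y(1) v(1)])
    show "AE x in lebesgue. x \<in> {0<..<L} \<longrightarrow> y4 x - (a + Q) * y2 x + (c + \<kappa>) * integral {0..L} y
      \<le> v4 x - (a + Q) * v2 x + (c + \<kappa>) * integral {0..L} v"
      using y(2) v(2) by eventually_elim (use rhs_mono(1)[OF assms(1-3)] in auto)
  qed
qed

abbreviation sine :: "real \<Rightarrow> real" where "sine \<equiv> \<lambda>x. lam * sin (pi / L * x)"
abbreviation sine2 :: "real \<Rightarrow> real" where "sine2 \<equiv> \<lambda>x. - lam * (pi / L) ^ 2 * sin (pi / L * x)"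

lemma navier_sine: "navier L sine sine2 (\<lambda>x. lam * (pi / L) ^ 4 * sin (pi / L * x))"
proof (rule navierI[where ?z1.0 = "\<lambda>x. lam * (pi / L) * cos (pi / L * x)"
      and ?z3.0 = "\<lambda>x. - lam * (pi / L) ^ 3 * cos (pi / L * x)"])
  fix x assume x: "x \<in> {0..L}"
  have "((\<lambda>x. lam * (pi / L) ^ 4 * sin (pi / L * x)) has_integral
      (- lam * (pi / L) ^ 3 * cos (pi / L * x) - - lam * (pi / L) ^ 3 * cos (pi / L * 0))) {0..x}"
    by (rule has_integral_derivative)
      (use x L in \<open>auto intro!: derivative_eq_intros simp: power_numeral_reduce\<close>)
  from integral_unique[OF this]
  show "- lam * (pi / L) ^ 3 * cos (pi / L * x) = - lam * (pi / L) ^ 3 * cos (pi / L * 0)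
      + integral {0..x} (\<lambda>x. lam * (pi / L) ^ 4 * sin (pi / L * x))"
    by linarith
qed (use L in \<open>auto intro!: derivative_eq_intros absolutely_integrable_continuous_real continuous_intros
    simp: power_numeral_reduce\<close>)

lemma navier_zero: "navier L (\<lambda>_. 0) (\<lambda>_. 0) (\<lambda>_. 0)"
  by (rule navierI[where ?z1.0 = "\<lambda>_. 0" and ?z3.0 = "\<lambda>_. 0"]) (use L in auto)

lemma inK_sine: "inK sine sine2" and inK_zero: "inK (\<lambda>_. 0) (\<lambda>_. 0)"
  using navier_sine navier_zero sin_nonneg lam by (auto simp: inK_def navier_def W41_on_def)

lemma inK_ord: "inK u u2 \<Longrightarrow> ord (\<lambda>_. 0) (\<lambda>_. 0) u u2" "inK u u2 \<Longrightarrow> ord u u2 sine sine2"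
  by (auto simp: inK_def ord_def)

lemma step_C2: "step u u2 y y2 \<Longrightarrow> C2_on L y y2"
  by (auto simp: step_def navier_def W41_on_def)

text \<open>The zero function is a subsolution because \<open>p\<close> is nonnegative and
  \<open>rhs\<close> is monotone; the sine is a supersolution because \<open>p_bound\<close> is
  exactly the inequality between \<open>rhs sine sine2\<close> and the linear operator applied to
  the sine.\<close>

lemma step_inK:
  assumes u: "inK u u2" and st: "step u u2 y y2"
  shows "inK y y2"
proof -
  obtain y4 where y: "navier L y y2 y4" "AE x in lebesgue. x \<in> {0<..<L} \<longrightarrow>
     y4 x - (a + Q) * y2 x + (c + \<kappa>) * integral {0..L} y = rhs u u2 x"
    using st unfolding step_def by blast
  have "ord (\<lambda>_. 0) (\<lambda>_. 0) y y2"
  proof (rule comparison[OF navier_zero y(1)])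
    have le: "0 \<le> rhs u u2 x" if "x \<in> {0<..<L}" "0 \<le> p x" for x
      using rhs_mono(1)[OF inK_zero u inK_ord(1)[OF u], of x] that by (simp add: rhs_def)
    show "AE x in lebesgue. x \<in> {0<..<L} \<longrightarrow> 0 - (a + Q) * 0 + (c + \<kappa>) * integral {0..L} (\<lambda>_. 0)
      \<le> y4 x - (a + Q) * y2 x + (c + \<kappa>) * integral {0..L} y"
      using y(2) p_nonneg by eventually_elim (use le in auto)
  qed
  moreover have "ord y y2 sine sine2"
  proof (rule comparison[OF y(1) navier_sine])
    have I: "integral {0..L} sine = 2 * lam * L / pi"
      by (rule integral_unique[OF sine_has_integral])
    have le: "rhs u u2 x \<le> lam * (pi / L) ^ 4 * sin (pi / L * x) - (a + Q) * sine2 x + (c + \<kappa>) * integral {0..L} sine"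
      if x: "x \<in> {0<..<L}"
        and px: "p x \<le> (lam * pi ^ 4 / L ^ 4 + a * lam * pi ^ 2 / L ^ 2 + 2 * b * lam ^ 2 * pi / L)
                 * sin (pi * x / L) + 2 * lam * c * L / pi" for x
    proof -
      have "rhs u u2 x \<le> rhs sine sine2 x"
        using rhs_mono(1)[OF u inK_sine inK_ord(2)[OF u], of x] x by simp
      \<comment> \<open>For the sine, b times the integral equals \<open>Q\<close>, so the
        second-derivative terms cancel and \<open>\<kappa>\<close> times the integral
        remains.\<close>
      also have "rhs sine sine2 x = p x + 2 * b * lam\<^sup>2 * pi / L"
        unfolding rhs_def I using L by (simp add: Q_def \<kappa>_def divide_simps) (simp add: algebra_simps power2_eq_square)
      also have "\<dots> \<le> (lam * pi ^ 4 / L ^ 4 + a * lam * pi ^ 2 / L ^ 2 + 2 * b * lam ^ 2 * pi / L)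
                 * sin (pi / L * x) + 2 * lam * c * L / pi + 2 * b * lam\<^sup>2 * pi / L"
        using px by simp
      also have "\<dots> = lam * (pi / L) ^ 4 * sin (pi / L * x) - (a + Q) * sine2 x + (c + \<kappa>) * integral {0..L} sine"
        unfolding I using L
        by (simp add: Q_def \<kappa>_def divide_simps) (simp add: algebra_simps power2_eq_square power_numeral_reduce)
      finally show ?thesis .
    qed
    show "AE x in lebesgue. x \<in> {0<..<L} \<longrightarrow> y4 x - (a + Q) * y2 x + (c + \<kappa>) * integral {0..L} y
      \<le> lam * (pi / L) ^ 4 * sin (pi / L * x) - (a + Q) * sine2 x + (c + \<kappa>) * integral {0..L} sine"
      using y(2) p_bound by eventually_elim (use le in auto)
  qed
  ultimately show ?thesis
    using y(1) by (auto simp: inK_def ord_def navier_def W41_on_def)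
qed

section \<open>Contraction of the gap between ordered elements\<close>

lemma parabola_has_integral: "((\<lambda>x. x * (L - x) / 2) has_integral L ^ 3 / 12) {0..L}"
proof -
  have "((\<lambda>x. x * (L - x) / 2) has_integral
      ((\<lambda>s. L * s\<^sup>2 / 4 - s ^ 3 / 6) L - (\<lambda>s. L * s\<^sup>2 / 4 - s ^ 3 / 6) 0)) {0..L}"
    by (rule has_integral_derivative) (use L in \<open>auto intro!: derivative_eq_intros simp: field_simps power2_eq_square\<close>)
  then show ?thesis by (simp add: power2_eq_square power3_eq_cube mult_ac)
qed

text \<open>The constant \<open>L ^ 3 / 12\<close> is the integral of the test parabola. The
  denominator exceeds the numerator by \<open>a + c * (L ^ 3 / 12)\<close>, which is why the ratio
  is below 1.\<close>

definition \<theta> :: real where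
  "\<theta> = (Q + \<kappa> * (L ^ 3 / 12)) / (a + Q + (c + \<kappa>) * (L ^ 3 / 12))"

lemma theta_bounds: "0 \<le> \<theta>" "\<theta> < 1"
proof -
  have "0 < \<kappa> * (L ^ 3 / 12)" "0 < c * (L ^ 3 / 12)"
    using \<kappa>_pos c L by simp_all
  then show "0 \<le> \<theta>" "\<theta> < 1"
    using a Q_pos by (auto simp: \<theta>_def algebra_simps divide_simps)
qed

text \<open>The parabola \<open>x (L - x) / 2\<close> has second derivative \<open>-1\<close>, so testing the equation for the
  difference against it turns \<open>-(v - y)''\<close> into \<open>v - y\<close> and yields a closed recursion for \<open>\<integral>(v - y)\<close>.\<close>
lemma step_gap:
  assumes u: "inK u u2" and w: "inK w w2" and le: "ord u u2 w w2"
    and st: "step u u2 y y2" "step w w2 v v2"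
  shows "integral {0..L} v - integral {0..L} y \<le> \<theta> * (integral {0..L} w - integral {0..L} u)"
    and "x \<in> {0..L} \<Longrightarrow> y2 x - v2 x \<le> Q * (w x - u x)
      + \<kappa> * (integral {0..L} w - integral {0..L} u) * (x * (L - x) / 2)"
proof -
  have ordv: "ord y y2 v v2" by (rule step_mono[OF assms])
  obtain y4 where y: "navier L y y2 y4" "AE x in lebesgue. x \<in> {0<..<L} \<longrightarrow>
     y4 x - (a + Q) * y2 x + (c + \<kappa>) * integral {0..L} y = rhs u u2 x"
    using st(1) unfolding step_def by blast
  obtain v4 where v: "navier L v v2 v4" "AE x in lebesgue. x \<in> {0<..<L} \<longrightarrow>
     v4 x - (a + Q) * v2 x + (c + \<kappa>) * integral {0..L} v = rhs w w2 x"
    using st(2) unfolding step_def by blast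
  define d d2 d4 where "d x = v x - y x" and "d2 x = v2 x - y2 x" and "d4 x = v4 x - y4 x" for x
  have d: "navier L d d2 d4"
    using navier_diff[OF y(1) v(1) less_imp_le[OF L]] unfolding d_def d2_def d4_def .
  define e e2 where "e x = w x - u x" and "e2 x = w2 x - u2 x" for x
  have e: "C2_on L e e2"
    using C2_on_diff[OF inK_C2[OF w] inK_C2[OF u]] unfolding e_def e2_def .
  define \<delta> where "\<delta> = integral {0..L} w - integral {0..L} u"
  define \<delta>' where "\<delta>' = integral {0..L} v - integral {0..L} y"
  have Id: "integral {0..L} d = \<delta>'"
    unfolding d_def \<delta>'_def using navier_continuous[OF y(1)] navier_continuous[OF v(1)]
    by (intro Henstock_Kurzweil_Integration.integral_diff integrable_continuous_real)
  have Ie: "integral {0..L} e = \<delta>"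
    unfolding e_def \<delta>_def using inK_cont[OF u] inK_cont[OF w]
    by (intro Henstock_Kurzweil_Integration.integral_diff integrable_continuous_real)
  have \<delta>0: "0 \<le> \<delta>"
    using ord_integral[OF le] inK_cont[OF u] inK_cont[OF w] by (simp add: \<delta>_def)
  have \<delta>'0: "0 \<le> \<delta>'"
    using ord_integral[OF ordv] navier_continuous[OF y(1)] navier_continuous[OF v(1)] by (simp add: \<delta>'_def)
  have d2_le: "d2 x \<le> 0" if "x \<in> {0..L}" for x
    using ordv that by (auto simp: ord_def d2_def)
  have ineq: "AE x in lebesgue. x \<in> {0<..<L} \<longrightarrow>
      d4 x \<le> (a + Q) * d2 x - (c + \<kappa>) * \<delta>' - Q * e2 x + \<kappa> * \<delta>"
    using y(2) v(2)
  proof eventually_elim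
    case (elim x)
    show ?case
    proof
      assume x: "x \<in> {0<..<L}"
      then have "rhs w w2 x - rhs u u2 x \<le> Q * (u2 x - w2 x) + \<kappa> * \<delta>"
        unfolding \<delta>_def using rhs_mono(2)[OF u w le] by simp
      with elim x show "d4 x \<le> (a + Q) * d2 x - (c + \<kappa>) * \<delta>' - Q * e2 x + \<kappa> * \<delta>"
        by (simp add: d4_def d2_def e2_def \<delta>'_def algebra_simps)
    qed
  qed
  obtain d1 d3 where d':
    "\<And>x. x \<in> {0..L} \<Longrightarrow> (d has_real_derivative d1 x) (at x within {0..L})"
    "\<And>x. x \<in> {0..L} \<Longrightarrow> (d1 has_real_derivative d2 x) (at x within {0..L})"
    "\<And>x. x \<in> {0..L} \<Longrightarrow> (d2 has_real_derivative d3 x) (at x within {0..L})"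
    "d4 absolutely_integrable_on {0..L}"
    "\<And>u x. 0 \<le> u \<Longrightarrow> u \<le> x \<Longrightarrow> x \<le> L \<Longrightarrow> d3 x = d3 u + integral {u..x} d4"
    and dends: "d 0 = 0" "d L = 0" "d2 0 = 0" "d2 L = 0"
    using navierE[OF d] by metis
  obtain e1 where e':
    "\<And>x. x \<in> {0..L} \<Longrightarrow> (e has_real_derivative e1 x) (at x within {0..L})"
    "\<And>x. x \<in> {0..L} \<Longrightarrow> (e1 has_real_derivative e2 x) (at x within {0..L})"
    using C2_onE[OF e] by metis
  have eends: "e 0 = 0" "e L = 0"
    using inK_ends[OF u] inK_ends[OF w] by (simp_all add: e_def)
  have L0: "0 \<le> L" using L by simp
  have parab: "((\<lambda>x. x * (L - x) / 2) has_real_derivative L / 2 - x) (at x within S)"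
    "((\<lambda>x. L / 2 - x) has_real_derivative -1) (at x within S)" for x S
    by (auto intro!: derivative_eq_intros simp: field_simps)
  have i1: "((\<lambda>x. x * (L - x) / 2 * d4 x - - 1 * d2 x) has_integral 0) {0..L}"
    by (rule navier_by_parts[OF d L0 parab]) auto
  have i2: "((\<lambda>x. x * (L - x) / 2 * d2 x) has_integral - \<delta>') {0..L}"
    using dirichlet_parabola_by_parts[OF d'(1,2) L0 dends(1,2)] Id by simp
  have i3: "((\<lambda>x. x * (L - x) / 2 * e2 x) has_integral - \<delta>) {0..L}"
    using dirichlet_parabola_by_parts[OF e' L0 eends] Ie by simp
  \<comment> \<open>The left integral is 0 by Green's identity. Its integrand is the tested
    \<open>d4\<close> plus \<open>d2\<close>; the latter is nonpositive and is dropped before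
    \<open>ineq\<close> is inserted.\<close>
  have "0 \<le> (a + Q) * - \<delta>' - Q * - \<delta> + (\<kappa> * \<delta> - (c + \<kappa>) * \<delta>') * (L ^ 3 / 12)"
  proof (rule has_integral_mono_AE[OF i1 has_integral_add[OF has_integral_diff[OF
          has_integral_mult_right[OF i2] has_integral_mult_right[OF i3]] has_integral_mult_right[OF parabola_has_integral]]])
    show "AE x in lebesgue. x \<in> {0<..<L} \<longrightarrow> x * (L - x) / 2 * d4 x - - 1 * d2 x
      \<le> (a + Q) * (x * (L - x) / 2 * d2 x) - Q * (x * (L - x) / 2 * e2 x)
        + (\<kappa> * \<delta> - (c + \<kappa>) * \<delta>') * (x * (L - x) / 2)"
      using ineq
    proof eventually_elim
      case (elim x)
      show ?case
      proof
        assume x: "x \<in> {0<..<L}"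
        then have "x * (L - x) / 2 * d4 x
            \<le> x * (L - x) / 2 * ((a + Q) * d2 x - (c + \<kappa>) * \<delta>' - Q * e2 x + \<kappa> * \<delta>)"
          using elim by (intro mult_left_mono) auto
        moreover have "x * (L - x) / 2 * ((a + Q) * d2 x - (c + \<kappa>) * \<delta>' - Q * e2 x + \<kappa> * \<delta>)
            = (a + Q) * (x * (L - x) / 2 * d2 x) - Q * (x * (L - x) / 2 * e2 x)
              + (\<kappa> * \<delta> - (c + \<kappa>) * \<delta>') * (x * (L - x) / 2)"
          by (simp only: ring_distribs mult_ac)
        ultimately show "x * (L - x) / 2 * d4 x - - 1 * d2 x
          \<le> (a + Q) * (x * (L - x) / 2 * d2 x) - Q * (x * (L - x) / 2 * e2 x)
            + (\<kappa> * \<delta> - (c + \<kappa>) * \<delta>') * (x * (L - x) / 2)"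
          using d2_le[of x] x by simp
      qed
    qed
  qed
  then have "(a + Q + (c + \<kappa>) * (L ^ 3 / 12)) * \<delta>' \<le> (Q + \<kappa> * (L ^ 3 / 12)) * \<delta>"
    by (simp add: algebra_simps)
  moreover have "0 < a + Q + (c + \<kappa>) * (L ^ 3 / 12)"
    using a Q_pos \<kappa>_pos c L by (intro add_pos_pos mult_pos_pos) auto
  ultimately have "\<delta>' \<le> \<theta> * \<delta>"
    unfolding \<theta>_def by (simp add: pos_le_divide_eq mult.commute)
  then show "integral {0..L} v - integral {0..L} y \<le> \<theta> * (integral {0..L} w - integral {0..L} u)"
    by (simp add: \<delta>_def \<delta>'_def)
  show "y2 x - v2 x \<le> Q * (w x - u x)
      + \<kappa> * (integral {0..L} w - integral {0..L} u) * (x * (L - x) / 2)" if x: "x \<in> {0..L}"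
  proof -
    \<comment> \<open>This function vanishes at both ends and is convex: by \<open>ineq\<close>,
      after dropping the nonpositive terms in \<open>d2\<close> and \<open>\<delta>'\<close>, its
      second derivative \<open>- d4 - Q * e2 + \<kappa> * \<delta>\<close> is nonnegative almost
      everywhere. Monotonicity of its first derivative is checked by integrating that bound.\<close>
    have "- d2 x - Q * e x - \<kappa> * \<delta> * (x * (L - x) / 2) \<le> 0"
    proof (rule nonpos_if_derivative_mono[where f = "\<lambda>x. - d2 x - Q * e x - \<kappa> * \<delta> * (x * (L - x) / 2)"
          and f' = "\<lambda>x. - d3 x - Q * e1 x - \<kappa> * \<delta> * (L / 2 - x)", OF _ _ _ _ x])
      show "((\<lambda>x. - d2 x - Q * e x - \<kappa> * \<delta> * (x * (L - x) / 2)) has_real_derivative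
          - d3 s - Q * e1 s - \<kappa> * \<delta> * (L / 2 - s)) (at s within {0..L})" if "s \<in> {0..L}" for s
        by (intro DERIV_diff DERIV_minus DERIV_cmult d'(3) e'(1) parab(1) that)
      fix s r assume sr: "0 \<le> s" "s \<le> r" "r \<le> L"
      have sub: "(f has_real_derivative f' t) (at t within {s..r})"
        if "\<And>x. x \<in> {0..L} \<Longrightarrow> (f has_real_derivative f' x) (at x within {0..L})" "t \<in> {s..r}" for f f' t
        using that(1)[of t] that(2) sr by (force intro: DERIV_subset)
      have "d4 integrable_on {s..r}"
        using d'(4) sr integrable_subinterval_real[of d4 0 L s r] by (auto simp: absolutely_integrable_on_def)
      then have j1: "(d4 has_integral (d3 r - d3 s)) {s..r}"
        using d'(5)[OF sr] integrable_integral by fastforce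
      have j2: "(e2 has_integral (e1 r - e1 s)) {s..r}"
        by (rule has_integral_derivative[OF sr(2) sub[OF e'(2)]])
      have j3: "((\<lambda>_. \<kappa> * \<delta>) has_integral (r - s) * (\<kappa> * \<delta>)) {s..r}"
        using has_integral_const_real[of "\<kappa> * \<delta>" s r] sr by simp
      have "d3 r - d3 s \<le> (r - s) * (\<kappa> * \<delta>) - Q * (e1 r - e1 s)"
      proof (rule has_integral_mono_AE[OF j1 has_integral_diff[OF j3 has_integral_mult_right[OF j2]]])
        have "d4 x \<le> \<kappa> * \<delta> - Q * e2 x" if "x \<in> {0<..<L}"
          "d4 x \<le> (a + Q) * d2 x - (c + \<kappa>) * \<delta>' - Q * e2 x + \<kappa> * \<delta>" for x
        proof -
          have "(a + Q) * d2 x \<le> 0" "0 \<le> (c + \<kappa>) * \<delta>'"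
            using d2_le[of x] that(1) \<delta>'0 a Q_pos c \<kappa>_pos by (auto simp: mult_le_0_iff)
          then show ?thesis using that(2) by linarith
        qed
        note * = this
        show "AE x in lebesgue. x \<in> {s<..<r} \<longrightarrow> d4 x \<le> \<kappa> * \<delta> - Q * e2 x"
          using ineq by eventually_elim (use * sr in auto)
      qed
      then show "- d3 s - Q * e1 s - \<kappa> * \<delta> * (L / 2 - s) \<le> - d3 r - Q * e1 r - \<kappa> * \<delta> * (L / 2 - r)"
        by (simp add: algebra_simps)
    qed (simp_all add: dends eends)
    then show ?thesis by (simp add: d2_def e_def \<delta>_def)
  qed
qed

lemma ord_gap_le_integral:
  assumes u: "inK u u2" and w: "inK w w2" and le: "ord u u2 w w2" and x: "x \<in> {0..L}"
  shows "w x - u x \<le> 6 / L * (integral {0..L} w - integral {0..L} u)"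
proof -
  have "w x - u x \<le> 6 / L * integral {0..L} (\<lambda>x. w x - u x)"
    by (rule concave_le_integral[OF L C2_on_diff[OF inK_C2[OF w] inK_C2[OF u]] _ _ _ x])
      (use inK_ends[OF u] inK_ends[OF w] le in \<open>auto simp: ord_def\<close>)
  also have "integral {0..L} (\<lambda>x. w x - u x) = integral {0..L} w - integral {0..L} u"
    using inK_cont[OF u] inK_cont[OF w]
    by (intro Henstock_Kurzweil_Integration.integral_diff integrable_continuous_real)
  finally show ?thesis .
qed

section \<open>Orbits of the iteration and their uniform gap\<close>

lemma chain_exists:
  assumes "C2_on L u u2"
  shows "\<exists>y y2. y 0 = u \<and> y2 0 = u2 \<and> chain y y2"
proof -
  \<comment> \<open>The clause for \<open>n = 0\<close> inside the invariant pins the starting pair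
    of the dependent choice.\<close>
  have "\<exists>f. \<forall>n. (C2_on L (fst (f n)) (snd (f n)) \<and> (n = 0 \<longrightarrow> f n = (u, u2)))
      \<and> step (fst (f n)) (snd (f n)) (fst (f (Suc n))) (snd (f (Suc n)))"
  proof (rule dependent_nat_choice)
    show "\<exists>z. C2_on L (fst z) (snd z) \<and> (0 = (0::nat) \<longrightarrow> z = (u, u2))"
      using assms by auto
    fix z and n :: nat
    assume "C2_on L (fst z) (snd z) \<and> (n = 0 \<longrightarrow> z = (u, u2))"
    then obtain y y2 where "step (fst z) (snd z) y y2" using step_exists by blast
    then show "\<exists>y. (C2_on L (fst y) (snd y) \<and> (Suc n = 0 \<longrightarrow> y = (u, u2)))
        \<and> step (fst z) (snd z) (fst y) (snd y)"
      using step_C2 by (intro exI[of _ "(y, y2)"]) auto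
  qed
  then obtain f where f: "\<And>n. n = 0 \<longrightarrow> f n = (u, u2)"
    "\<And>n. step (fst (f n)) (snd (f n)) (fst (f (Suc n))) (snd (f (Suc n)))"
    by blast
  then show ?thesis
    by (intro exI[of _ "\<lambda>n. fst (f n)"] exI[of _ "\<lambda>n. snd (f n)"]) (auto simp: chain_def)
qed

lemma chain_inK:
  assumes "chain y y2" "inK (y 0) (y2 0)"
  shows "inK (y n) (y2 n)"
  using assms by (induction n) (auto simp: chain_def intro: step_inK)

lemma chain_mono:
  assumes "chain y y2" "inK (y 0) (y2 0)" "chain v v2" "inK (v 0) (v2 0)" "ord (y 0) (y2 0) (v 0) (v2 0)"
  shows "ord (y n) (y2 n) (v n) (v2 n)"
proof (induction n)
  case (Suc n)
  show ?case
    using step_mono[OF chain_inK[OF assms(1,2)] chain_inK[OF assms(3,4)] Suc] assms(1,3)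
    by (auto simp: chain_def)
qed (use assms in simp)

text \<open>Iterating the contraction gives decay of the integrals, and concavity of the differences
  makes it uniform. The second derivatives at \<open>Suc n\<close> are paired with
  \<open>\<theta> ^ n\<close> because they are controlled by the function gap of the preceding
  step.\<close>

lemma chain_gap:
  assumes y: "chain y y2" "inK (y 0) (y2 0)" and v: "chain v v2" "inK (v 0) (v2 0)"
    and le: "ord (y 0) (y2 0) (v 0) (v2 0)"
  obtains C where "\<And>n x. x \<in> {0..L} \<Longrightarrow> v n x - y n x \<le> C * \<theta> ^ n"
    "\<And>n x. x \<in> {0..L} \<Longrightarrow> y2 (Suc n) x - v2 (Suc n) x \<le> C * \<theta> ^ n"
proof -
  define \<delta> where "\<delta> n = integral {0..L} (v n) - integral {0..L} (y n)" for n
  note K = chain_inK[OF y] chain_inK[OF v]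
  have le: "ord (y n) (y2 n) (v n) (v2 n)" for n by (rule chain_mono[OF y v le])
  have \<delta>0: "0 \<le> \<delta> n" for n
    using ord_integral[OF le inK_cont(1)[OF K(1)] inK_cont(1)[OF K(2)]] by (simp add: \<delta>_def)
  have st: "step (y n) (y2 n) (y (Suc n)) (y2 (Suc n))" "step (v n) (v2 n) (v (Suc n)) (v2 (Suc n))" for n
    using y v by (auto simp: chain_def)
  have \<delta>n: "\<delta> n \<le> \<delta> 0 * \<theta> ^ n" for n
  proof (induction n)
    case (Suc n)
    have "\<delta> (Suc n) \<le> \<theta> * \<delta> n"
      unfolding \<delta>_def by (rule step_gap(1)[OF K le st])
    also have "\<dots> \<le> \<theta> * (\<delta> 0 * \<theta> ^ n)" using Suc theta_bounds by (intro mult_left_mono) auto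
    finally show ?case by (simp add: mult_ac)
  qed simp
  \<comment> \<open>The constants of both estimates are added so that one \<open>C\<close> serves
    both; \<open>L * L\<close> is a crude bound for the parabola.\<close>
  define C where "C = (Q * (6 / L) + 6 / L + \<kappa> * (L * L)) * \<delta> 0"
  have e: "v n x - y n x \<le> 6 / L * \<delta> n" if "x \<in> {0..L}" for n x
    unfolding \<delta>_def by (rule ord_gap_le_integral[OF K le that])
  have 1: "v n x - y n x \<le> C * \<theta> ^ n" if x: "x \<in> {0..L}" for n x
  proof -
    have "v n x - y n x \<le> 6 / L * \<delta> n" by (rule e[OF x])
    also have "\<dots> \<le> (Q * (6 / L) + 6 / L + \<kappa> * (L * L)) * \<delta> n"
      using \<delta>0 Q_pos \<kappa>_pos L by (intro mult_right_mono) auto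
    also have "\<dots> \<le> (Q * (6 / L) + 6 / L + \<kappa> * (L * L)) * (\<delta> 0 * \<theta> ^ n)"
      using \<delta>n Q_pos \<kappa>_pos L by (intro mult_left_mono) auto
    finally show ?thesis by (simp add: C_def mult_ac)
  qed
  have 2: "y2 (Suc n) x - v2 (Suc n) x \<le> C * \<theta> ^ n" if x: "x \<in> {0..L}" for n x
  proof -
    have "y2 (Suc n) x - v2 (Suc n) x \<le> Q * (v n x - y n x) + \<kappa> * \<delta> n * (x * (L - x) / 2)"
      unfolding \<delta>_def by (rule step_gap(2)[OF K le st x])
    also have "\<dots> \<le> Q * (6 / L * \<delta> n) + \<kappa> * \<delta> n * (L * L)"
    proof (intro add_mono mult_left_mono e[OF x])
      have "x * (L - x) \<le> L * L" using x by (intro mult_mono) auto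
      moreover have "0 \<le> x * (L - x)" using x by simp
      ultimately show "x * (L - x) / 2 \<le> L * L" by linarith
    qed (use Q_pos \<kappa>_pos \<delta>0 in auto)
    also have "\<dots> \<le> (Q * (6 / L) + 6 / L + \<kappa> * (L * L)) * \<delta> n"
      using \<delta>0[of n] L by (simp add: algebra_simps)
    also have "\<dots> \<le> (Q * (6 / L) + 6 / L + \<kappa> * (L * L)) * (\<delta> 0 * \<theta> ^ n)"
      using \<delta>n Q_pos \<kappa>_pos L by (intro mult_left_mono) auto
    finally show ?thesis by (simp add: C_def mult_ac)
  qed
  show thesis using that 1 2 by blast
qed

section \<open>Existence and positivity of a fixed point\<close>

lemma chain_shift: "chain y y2 \<Longrightarrow> chain (\<lambda>n. y (n + k)) (\<lambda>n. y2 (n + k))"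
  by (simp add: chain_def)

lemma chain_const: "step v v2 v v2 \<Longrightarrow> chain (\<lambda>_. v) (\<lambda>_. v2)"
  by (simp add: chain_def)

lemma ord_trans: "ord u u2 v v2 \<Longrightarrow> ord v v2 w w2 \<Longrightarrow> ord u u2 w w2"
  unfolding ord_def by force

text \<open>Values enclosed by the same intervals of geometrically shrinking length must agree.
  Fixed points are identified in this way, without a limit in the equation.\<close>

lemma squeeze_tendsto_eq:
  fixes s t :: real
  assumes "\<And>n. l n \<le> s" "\<And>n. l n \<le> t" "\<And>n. s \<le> r n" "\<And>n. t \<le> r n" "\<And>n. r n - l n \<le> C * \<theta> ^ n"
  shows "s = t"
proof -
  have "(\<lambda>n. C * \<theta> ^ n) \<longlonglongrightarrow> C * 0"
    using theta_bounds by (intro tendsto_intros) auto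
  moreover have "\<bar>s - t\<bar> \<le> C * \<theta> ^ n" for n
    using assms(1-4)[of n] assms(5)[of n] by linarith
  ultimately have "\<bar>s - t\<bar> \<le> 0"
    by (intro LIMSEQ_le_const[of "\<lambda>n. C * \<theta> ^ n"]) auto
  then show ?thesis by simp
qed

text \<open>By concavity, a zero inside the interval forces \<open>v\<close> and then
  \<open>v2\<close> to vanish, and the equation reduces to \<open>v4 = p\<close> almost everywhere.
  Testing with the parabola, which is positive inside, gives a nonnegative integrand with integral
  0, hence \<open>p = 0\<close> almost everywhere.\<close>

lemma solution_pos:
  assumes p_nz: "\<not> (AE x in lebesgue. x \<in> {0..L} \<longrightarrow> p x = 0)"
    and v: "inK v v2" and st: "step v v2 v v2" and x: "x \<in> {0<..<L}"
  shows "0 < v x"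
proof (rule ccontr)
  assume "\<not> 0 < v x"
  have zero: "v s = 0" if s: "s \<in> {0..L}" for s
  proof -
    have "v s / L\<^sup>2 * (x * (L - x)) \<le> v x"
      by (rule concave_ge_parabola[OF L inK_C2[OF v] inK_ends[OF v]]) (use v x s in \<open>auto simp: inK_def\<close>)
    also have "\<dots> \<le> 0" using \<open>\<not> 0 < v x\<close> by simp
    finally have "v s \<le> 0" using x L by (auto simp: mult_le_0_iff divide_le_0_iff)
    then show ?thesis using v s by (force simp: inK_def)
  qed
  have "C2_on L v (\<lambda>_. 0)"
    unfolding C2_on_def
  proof (intro exI[of _ "\<lambda>_. 0"] conjI ballI)
    fix s assume s: "s \<in> {0..L}"
    show "(v has_real_derivative 0) (at s within {0..L})"
      by (rule has_field_derivative_transform_within[OF DERIV_const[of 0] zero_less_one s]) (simp add: zero)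
  qed auto
  then have v2: "v2 s = 0" if "s \<in> {0..L}" for s
    using C2_on_unique[OF L inK_C2[OF v] _ that] by blast
  obtain v4 where v4: "navier L v v2 v4" "AE x in lebesgue. x \<in> {0<..<L} \<longrightarrow>
     v4 x - (a + Q) * v2 x + (c + \<kappa>) * integral {0..L} v = rhs v v2 x"
    using st unfolding step_def by blast
  have "integral {0..L} v = integral {0..L} (\<lambda>_. 0)"
    by (rule integral_cong) (rule zero)
  then have I0: "integral {0..L} v = 0" by simp
  have v4p: "AE x in lebesgue. x \<in> {0<..<L} \<longrightarrow> v4 x = p x"
    using v4(2) by eventually_elim (auto simp: rhs_def v2 I0)
  let ?e = "\<lambda>x. x * (L - x) / 2"
  have 1: "((\<lambda>x. ?e x * v4 x - -1 * v2 x) has_integral 0) {0..L}"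
    by (rule navier_by_parts[OF v4(1), of _ "\<lambda>x. L / 2 - x"])
      (use L in \<open>auto intro!: derivative_eq_intros simp: field_simps\<close>)
  have 2: "((\<lambda>x. ?e x * v4 x) has_integral 0) {0..L}"
    by (rule has_integral_eq[OF _ 1]) (simp add: v2)
  have v4i: "v4 absolutely_integrable_on {0..L}"
    using navierE[OF v4(1)] by metis
  have 3: "(\<lambda>x. ?e x * v4 x) absolutely_integrable_on {0..L}"
    by (rule absolutely_integrable_continuous_mult[OF _ v4i]) (auto intro!: continuous_intros)
  have "AE x in lebesgue. 0 \<le> indicator {0..L} x *\<^sub>R (?e x * v4 x)"
    using v4p p_nonneg
  proof eventually_elim
    case (elim x)
    show ?case
      using elim by (cases "x \<in> {0<..<L}") (auto simp: indicator_def)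
  qed
  moreover have "integrable lebesgue (\<lambda>x. indicator {0..L} x *\<^sub>R (?e x * v4 x))"
    using 3 by (simp add: set_integrable_def)
  moreover have "integral\<^sup>L lebesgue (\<lambda>x. indicator {0..L} x *\<^sub>R (?e x * v4 x)) = 0"
    using set_lebesgue_integral_eq_integral(2)[OF 3] integral_unique[OF 2]
    by (simp add: set_lebesgue_integral_def)
  ultimately have "AE x in lebesgue. indicator {0..L} x *\<^sub>R (?e x * v4 x) = 0"
    using integral_nonneg_eq_0_iff_AE by blast
  moreover have "AE x in lebesgue. x \<noteq> 0 \<and> x \<noteq> L"
  proof -
    have "negligible {0, L}" by simp
    then show ?thesis unfolding eventually_ae_filter_negligible by (intro exI[of _ "{0, L}"]) auto
  qed
  ultimately have "AE x in lebesgue. x \<in> {0..L} \<longrightarrow> p x = 0"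
    using v4p by eventually_elim (auto simp: indicator_def)
  with p_nz show False by contradiction
qed

text \<open>The two monotone sequences started at the ends of the order interval enclose a common limit;
  applying one step to the limit gives a function that is enclosed as well, hence a fixed point.\<close>
lemma enclosing_chains:
  obtains l l2 s s2 v v2 C where
    "chain l l2" "l 0 = (\<lambda>_. 0)" "l2 0 = (\<lambda>_. 0)" "chain s s2" "s 0 = sine" "s2 0 = sine2"
    "\<And>n x. x \<in> {0..L} \<Longrightarrow> s n x - l n x \<le> C * \<theta> ^ n"
    "inK v v2" "step v v2 v v2"
proof -
  obtain l l2 where l: "l 0 = (\<lambda>_. 0)" "l2 0 = (\<lambda>_. 0)" "chain l l2"
    using chain_exists[OF inK_C2[OF inK_zero]] by blast
  obtain s s2 where s: "s 0 = sine" "s2 0 = sine2" "chain s s2"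
    using chain_exists[OF inK_C2[OF inK_sine]] by blast
  have K0: "inK (l 0) (l2 0)" "inK (s 0) (s2 0)"
    using inK_zero inK_sine l s by simp_all
  have ls0: "ord (l 0) (l2 0) (s 0) (s2 0)"
    using inK_ord(2)[OF inK_zero] l s by simp
  obtain C where C: "\<And>n x. x \<in> {0..L} \<Longrightarrow> s n x - l n x \<le> C * \<theta> ^ n"
    "\<And>n x. x \<in> {0..L} \<Longrightarrow> l2 (Suc n) x - s2 (Suc n) x \<le> C * \<theta> ^ n"
    using chain_gap[OF l(3) K0(1) s(3) K0(2) ls0] by metis
  note K = chain_inK[OF l(3) K0(1)] chain_inK[OF s(3) K0(2)]
  \<comment> \<open>The orbit of \<open>0\<close> is compared with its own shift: its first term
    lies below every element of the order interval, so monotonicity propagates. The orbit of the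
    sine decreases for the dual reason.\<close>
  have lup: "ord (l n) (l2 n) (l (n + k)) (l2 (n + k))" for n k
    using chain_mono[OF l(3) K0(1) chain_shift[OF l(3)], of k n] inK_ord(1)[OF K(1)[of k]] K(1)[of k] l by simp
  have sdown: "ord (s (n + k)) (s2 (n + k)) (s n) (s2 n)" for n k
    using chain_mono[OF chain_shift[OF s(3), of k] _ s(3) K0(2), of n] inK_ord(2)[OF K(2)[of k]] K(2)[of k] s by simp
  have ls: "ord (l n) (l2 n) (s n) (s2 n)" for n
    by (rule chain_mono[OF l(3) K0(1) s(3) K0(2) ls0])
  have lsk: "ord (l k) (l2 k) (s n) (s2 n)" for k n
  proof (cases "k \<le> n")
    case True
    then show ?thesis using ord_trans[OF lup[of k "n - k"] ] ls[of n] by simp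
  next
    case False
    then show ?thesis using ord_trans[OF ls[of k]] sdown[of n "k - n"] by simp
  qed
  \<comment> \<open>The limit is taken for the second derivatives, which decrease in
    \<open>n\<close> and are bounded below by every \<open>s2 n\<close>. Their convergence is
    uniform, so \<open>W2\<close> is continuous and \<open>w\<close> is recovered by solving a
    Dirichlet problem.\<close>
  define W2 where "W2 x = (INF n. l2 n x)" for x
  have W2: "s2 n x \<le> W2 x" "W2 x \<le> l2 n x" if x: "x \<in> {0..L}" for n x
  proof -
    have le: "s2 n x \<le> l2 k x" for k n using lsk[of k n] x by (auto simp: ord_def)
    then show "s2 n x \<le> W2 x" unfolding W2_def by (intro cINF_greatest) auto
    have "bdd_below (range (\<lambda>n. l2 n x))" using le by (intro bdd_belowI[of _ "s2 0 x"]) auto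
    then show "W2 x \<le> l2 n x" unfolding W2_def by (intro cINF_lower) auto
  qed
  have lim0: "(\<lambda>n. C * \<theta> ^ n) \<longlonglongrightarrow> 0"
    using tendsto_mult[OF tendsto_const LIMSEQ_realpow_zero[OF theta_bounds], of C] by simp
  have "uniform_limit {0..L} (\<lambda>n. l2 (Suc n)) W2 sequentially"
  proof (rule uniform_limitI)
    fix \<epsilon> :: real assume "\<epsilon> > 0"
    then have "\<forall>\<^sub>F n in sequentially. C * \<theta> ^ n < \<epsilon>"
      using order_tendstoD(2)[OF lim0] by blast
    then show "\<forall>\<^sub>F n in sequentially. \<forall>x\<in>{0..L}. dist (l2 (Suc n) x) (W2 x) < \<epsilon>"
    proof eventually_elim
      case (elim n)
      show ?case
      proof
        fix x assume x: "x \<in> {0..L}"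
        show "dist (l2 (Suc n) x) (W2 x) < \<epsilon>"
          using W2[OF x, of "Suc n"] C(2)[OF x, of n] elim by (simp add: dist_real_def)
      qed
    qed
  qed
  then have "continuous_on {0..L} W2"
    by (rule uniform_limit_theorem[rotated]) (use inK_cont(2)[OF K(1)] in auto)
  then obtain w where w: "C2_on L w W2" "w 0 = 0" "w L = 0"
    using dirichlet_exists[OF L] by blast
  have lw: "ord (l n) (l2 n) w W2" and ws: "ord w W2 (s n) (s2 n)" for n
    using dirichlet_comparison[OF inK_C2[OF K(1)[of n]] w(1)] dirichlet_comparison[OF w(1) inK_C2[OF K(2)[of n]]]
      W2[of _ n] w inK_ends[OF K(1)[of n]] inK_ends[OF K(2)[of n]]
    by (auto simp: ord_def)
  have wK: "inK w W2"
    using lw[of 0] ws[of 0] w(1) l s by (simp add: inK_def ord_def)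
  obtain v v2 where v: "step w W2 v v2" using step_exists[OF w(1)] by blast
  have lv: "ord (l (Suc n)) (l2 (Suc n)) v v2" and vs: "ord v v2 (s (Suc n)) (s2 (Suc n))" for n
    using step_mono[OF K(1) wK lw _ v] step_mono[OF wK K(2) ws v] l(3) s(3)
    unfolding chain_def by blast+
  have vw: "v x = w x" and vw2: "v2 x = W2 x" if x: "x \<in> {0..L}" for x
  proof -
    show "v x = w x"
    proof (rule squeeze_tendsto_eq)
      show "s (Suc n) x - l (Suc n) x \<le> C * \<theta> * \<theta> ^ n" for n
        using C(1)[OF x, of "Suc n"] by (simp add: mult_ac)
    qed (use lv vs lw ws x in \<open>auto simp: ord_def\<close>)
    show "v2 x = W2 x"
    proof (rule squeeze_tendsto_eq[OF _ _ _ _ C(2)[OF x]])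
    qed (use lv vs lw ws x in \<open>auto simp: ord_def\<close>)
  qed
  have "integral {0..L} v = integral {0..L} w"
    by (rule integral_cong) (rule vw)
  then have rhs: "rhs v v2 x = rhs w W2 x" if "x \<in> {0<..<L}" for x
    using vw2[of x] that by (simp add: rhs_def)
  obtain v4 where v4: "navier L v v2 v4" "AE x in lebesgue. x \<in> {0<..<L} \<longrightarrow>
     v4 x - (a + Q) * v2 x + (c + \<kappa>) * integral {0..L} v = rhs w W2 x"
    using v unfolding step_def by blast
  have "AE x in lebesgue. x \<in> {0<..<L} \<longrightarrow>
     v4 x - (a + Q) * v2 x + (c + \<kappa>) * integral {0..L} v = rhs v v2 x"
    using v4(2) by eventually_elim (simp add: rhs)
  then have "step v v2 v v2" using v4(1) unfolding step_def by blast
  then show thesis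
    using that[OF l(3,1,2) s(3,1,2) C(1) step_inK[OF wK v]] by blast
qed

end

section \<open>Uniqueness and uniform convergence from the enclosure\<close>

theorem theorem5p2:
  fixes L a b c lam :: real and p :: "real \<Rightarrow> real"
  assumes L: "L > 0" and a: "a > 0" and b: "b > 0" and c: "c > 0" and lam: "lam > 0"
    and p_int: "p absolutely_integrable_on {0..L}"
    and p_nonneg: "AE x in lebesgue. x \<in> {0..L} \<longrightarrow> 0 \<le> p x"
    and p_bound: "AE x in lebesgue. x \<in> {0..L} \<longrightarrow>
        p x \<le> (lam * pi ^ 4 / L ^ 4 + a * lam * pi ^ 2 / L ^ 2 + 2 * b * lam ^ 2 * pi / L)
                 * sin (pi * x / L) + 2 * lam * c * L / pi"
    and MN: "c + b * lam * pi ^ 2 / L ^ 2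
        \<le> 4 * (a + 2 * b * lam * L / pi) / L ^ 3 * sigma5 (sqrt (a + 2 * b * lam * L / pi) * L)"
    and p_nz: "\<not> (AE x in lebesgue. x \<in> {0..L} \<longrightarrow> p x = 0)"
    and small: "lam * L ^ 3 / 4 * (2 * b / pi + b * pi ^ 2 / 4) \<le> 1"
  shows "\<exists>w. solves_P L a b c p w \<and> setK L lam w \<and> (\<forall>x\<in>{0<..<L}. w x > 0)
          \<and> (\<forall>v. solves_P L a b c p v \<and> setK L lam v \<and> (\<forall>x\<in>{0<..<L}. v x > 0)
                 \<longrightarrow> (\<forall>x\<in>{0..L}. v x = w x))
          \<and> (\<forall>u0. setK L lam u0 \<longrightarrow>
                 (\<exists>y. iter_seq L a b c lam p y \<and> y 0 = u0)
               \<and> (\<forall>y. iter_seq L a b c lam p y \<and> y 0 = u0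
                      \<longrightarrow> uniform_limit {0..L} y w sequentially))"
proof -
  interpret beam L a b c lam p
    by (rule beam.intro[OF L a b c lam p_int p_nonneg p_bound MN])
  obtain l l2 s s2 w w2 C where l: "chain l l2" "l 0 = (\<lambda>_. 0)" "l2 0 = (\<lambda>_. 0)"
    and s: "chain s s2" "s 0 = sine" "s2 0 = sine2"
    and C: "\<And>n x. x \<in> {0..L} \<Longrightarrow> s n x - l n x \<le> C * \<theta> ^ n"
    and w: "inK w w2" "step w w2 w w2"
    by (rule enclosing_chains, rule that, assumption+)
  have K0: "inK (l 0) (l2 0)" "inK (s 0) (s2 0)"
    using inK_zero inK_sine l s by simp_all
  have enclose: "l n x \<le> y n x \<and> y n x \<le> s n x" if y: "chain y y2" "inK (y 0) (y2 0)" and x: "x \<in> {0..L}" for y y2 n x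
    using chain_mono[OF l(1) K0(1) y, of n] chain_mono[OF y s(1) K0(2), of n]
      inK_ord[OF y(2)] l s x by (auto simp: ord_def)
  \<comment> \<open>A solution in the order interval is a constant orbit, so it is enclosed like any
    other orbit.\<close>
  have encl_w: "l n x \<le> w x \<and> w x \<le> s n x" if "x \<in> {0..L}" for n x
    using enclose[OF chain_const[OF w(2)] w(1) that] by simp
  have uniq: "v x = w x" if v: "solves_P L a b c p v" "setK L lam v" and x: "x \<in> {0..L}" for v x
  proof -
    obtain v2 where v2: "step v v2 v v2" using v(1) unfolding solves_P_iff by blast
    obtain u2 where u2: "inK v u2" using v(2) unfolding setK_iff by blast
    \<comment> \<open>The second derivatives supplied by \<open>solves_P\<close> and by
      \<open>setK\<close> may be different witnesses; they agree on the interval by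
      uniqueness.\<close>
    have "inK v v2"
      using u2 step_C2[OF v2] C2_on_unique[OF L step_C2[OF v2] inK_C2[OF u2]] by (auto simp: inK_def)
    from enclose[OF chain_const[OF v2] this x] encl_w[OF x] show ?thesis
      by (intro squeeze_tendsto_eq[OF _ _ _ _ C[OF x]]) auto
  qed
  have ex: "\<exists>y. iter_seq L a b c lam p y \<and> y 0 = u0" if u0: "setK L lam u0" for u0
  proof -
    obtain u2 where u2: "inK u0 u2" using u0 unfolding setK_iff by blast
    then obtain y y2 where "y 0 = u0" "y2 0 = u2" "chain y y2"
      using chain_exists[OF inK_C2] by blast
    then show ?thesis using inK_C2[OF u2] unfolding iter_seq_iff by blast
  qed
  have conv: "uniform_limit {0..L} y w sequentially" if u0: "setK L lam (y 0)" and y: "iter_seq L a b c lam p y" for y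
  proof -
    obtain y2 where y2: "C2_on L (y 0) (y2 0)" "chain y y2" using y unfolding iter_seq_iff by blast
    obtain u2 where u2: "inK (y 0) u2" using u0 unfolding setK_iff by blast
    have yK: "inK (y 0) (y2 0)"
      using u2 y2(1) C2_on_unique[OF L y2(1) inK_C2[OF u2]] by (auto simp: inK_def)
    have lim0: "(\<lambda>n. C * \<theta> ^ n) \<longlonglongrightarrow> 0"
      using tendsto_mult[OF tendsto_const LIMSEQ_realpow_zero[OF theta_bounds], of C] by simp
    show ?thesis
    proof (rule uniform_limitI)
      fix \<epsilon> :: real assume "\<epsilon> > 0"
      then have "\<forall>\<^sub>F n in sequentially. C * \<theta> ^ n < \<epsilon>"
        using order_tendstoD(2)[OF lim0] by blast
      then show "\<forall>\<^sub>F n in sequentially. \<forall>x\<in>{0..L}. dist (y n x) (w x) < \<epsilon>"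
      proof eventually_elim
        case (elim n)
        show ?case
        proof
          fix x assume x: "x \<in> {0..L}"
          show "dist (y n x) (w x) < \<epsilon>"
            using enclose[OF y2(2) yK x, of n] encl_w[OF x, of n] C[OF x, of n] elim
            unfolding dist_real_def by linarith
        qed
      qed
    qed
  qed
  have sol: "solves_P L a b c p w" "setK L lam w" "\<forall>x\<in>{0<..<L}. w x > 0"
    using w solution_pos[OF p_nz w] unfolding solves_P_iff setK_iff by blast+
  show ?thesis
    by (intro exI[of _ w] conjI allI impI ballI sol) (use sol uniq ex conv in \<open>blast+\<close>)
qed

end
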